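(* Let $k\ge3$ be an integer, and set \[ \alpha_k:=\liminf_{N\to\infty}\frac{\log f_k(N)}{\log\log N},\qquad \beta_k:=\limsup_{N\to\infty}\frac{\log f_k(N)}{\log\log N}. \] Then $\alpha_k=\beta_k$, i.e. the limit $\gamma_k:=\lim_{N\to\infty}\frac{\log f_k(N)}{\log\log N}=\alpha_k=\beta_k$ exists, and \[ \gamma_k=\lim_{z\to\infty}\bigl(\Lambda_k(z)-z\bigr)=\inf_{z>0}\bigl(\Lambda_k(z)-z\bigr) =\sup_{z>0}z\log\frac{\Lambda_k(z)}{z}=\sup_{u>0}\frac{\log\widetilde\Lambda_k(u)}{u}. \] Equivalently, \[ \gamma_k=\lim_{u\downarrow0}\frac{\widetilde\Lambda_k(u)-1}{u}. \]
   Context: Write $[n]=\{1,\dots,n\}$. A set $A\subseteq[N]$ is LCM-$k$-free if it contains no $k$ distinct integers $a_1,\dots,a_k$ for which $\operatorname{lcm}(a_i,a_j)$ is the same for all pairs $1\le i<j\le k$; $f_k(N):=\max\{\sum_{a\in A}1/a : A\subseteq[N]\text{ is LCM-}k\text{-free}\}$. Distinct sets $S_1,\dots,S_k$ form a $k$-sunflower (resp. $k$-cosunflower) if their pairwise intersections (resp. pairwise unions) are all equal; a family of sets is $k$-sunflower-free (resp. $k$-cosunflower-free) if no $k$ distinct members form one. For real $z>0$ let \[ W_k(n;z):=\max\Big\{\sum_{S\in\mathcal F}z^{|S|}:\mathcal F\subseteq2^{[n]}\ k\text{-sunflower-free}\Big\},\quad C_k(n;z):=\max\Big\{\sum_{S\in\mathcal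 G}z^{|S|}:\mathcal G\subseteq2^{[n]}\ k\text{-cosunflower-free}\Big\}, \] and $\Lambda_k(z):=\lim_{n\to\infty}W_k(n;z)^{1/n}$, $\widetilde\Lambda_k(z):=\lim_{n\to\infty}C_k(n;z)^{1/n}$ (these limits exist for all $k\ge3$, $z>0$). *)

theory Defs
  imports Complex_Main "HOL-Library.Extended_Real"
begin

definition lcm_k_free :: "nat \<Rightarrow> nat set \<Rightarrow> bool" where
  "lcm_k_free k A \<longleftrightarrow>
     \<not> (\<exists>a :: nat \<Rightarrow> nat. inj_on a {1..k} \<and> a ` {1..k} \<subseteq> A \<and>
          (\<exists>L. \<forall>i\<in>{1..k}. \<forall>j\<in>{1..k}. i < j \<longrightarrow> lcm (a i) (a j) = L))"

definition lcm_free_max :: "nat \<Rightarrow> nat \<Rightarrow> real" where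
  "lcm_free_max k N = Max {\<Sum>a\<in>A. 1 / real a | A. A \<subseteq> {1..N} \<and> lcm_k_free k A}"

definition sunflower :: "nat \<Rightarrow> (nat \<Rightarrow> 'a set) \<Rightarrow> bool" where
  "sunflower k S \<longleftrightarrow>
     inj_on S {1..k} \<and> (\<exists>K. \<forall>i\<in>{1..k}. \<forall>j\<in>{1..k}. i < j \<longrightarrow> S i \<inter> S j = K)"

definition cosunflower :: "nat \<Rightarrow> (nat \<Rightarrow> 'a set) \<Rightarrow> bool" where
  "cosunflower k S \<longleftrightarrow>
     inj_on S {1..k} \<and> (\<exists>K. \<forall>i\<in>{1..k}. \<forall>j\<in>{1..k}. i < j \<longrightarrow> S i \<union> S j = K)"

definition sunflower_free :: "nat \<Rightarrow> 'a set set \<Rightarrow> bool" where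
  "sunflower_free k F \<longleftrightarrow> \<not> (\<exists>S. S ` {1..k} \<subseteq> F \<and> sunflower k S)"

definition cosunflower_free :: "nat \<Rightarrow> 'a set set \<Rightarrow> bool" where
  "cosunflower_free k F \<longleftrightarrow> \<not> (\<exists>S. S ` {1..k} \<subseteq> F \<and> cosunflower k S)"

definition sunflower_weight :: "nat \<Rightarrow> nat \<Rightarrow> real \<Rightarrow> real" where
  "sunflower_weight k n z =
     Max {\<Sum>S\<in>F. z ^ card S | F. F \<subseteq> Pow {1..n} \<and> sunflower_free k F}"

definition cosunflower_weight :: "nat \<Rightarrow> nat \<Rightarrow> real \<Rightarrow> real" where
  "cosunflower_weight k n z =
     Max {\<Sum>S\<in>G. z ^ card S | G. G \<subseteq> Pow {1..n} \<and> cosunflower_free k G}"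

text \<open>Both limits exist for \<open>k \<ge> 3\<close> and \<open>z > 0\<close>; outside this range
  \<^const>\<open>lim\<close> may be unspecified.\<close>

definition sunflower_rate :: "nat \<Rightarrow> real \<Rightarrow> real" where
  "sunflower_rate k z = lim (\<lambda>n. root n (sunflower_weight k n z))"

definition cosunflower_rate :: "nat \<Rightarrow> real \<Rightarrow> real" where
  "cosunflower_rate k z = lim (\<lambda>n. root n (cosunflower_weight k n z))"

definition lcm_log_ratio :: "nat \<Rightarrow> nat \<Rightarrow> real" where
  "lcm_log_ratio k N = ln (lcm_free_max k N) / ln (ln (real N))"

definition lcm_lower_exponent :: "nat \<Rightarrow> ereal" where
  "lcm_lower_exponent k = liminf (\<lambda>N. ereal (lcm_log_ratio k N))"

definition lcm_upper_exponent :: "nat \<Rightarrow> ereal" where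
  "lcm_upper_exponent k = limsup (\<lambda>N. ereal (lcm_log_ratio k N))"

end

theory Submission
  imports
    Defs
    "HOL-Library.FuncSet"
    "HOL-Real_Asymp.Real_Asymp"
    "HOL-Computational_Algebra.Squarefree"
begin

text \<open>
  Complementation turns \<open>k\<close>-sunflowers into \<open>k\<close>-cosunflowers, so the rates \<open>\<Lambda>\<close> and \<open>c\<close> of the two
  problems satisfy \<open>\<Lambda> z = z * c (1 / z)\<close>, and everything can be phrased in terms of \<open>c\<close>. Families
  whose members all have the same size lose only a linear factor and are well behaved: in a set
  system of pairwise equal unions two equal members force all members to be equal. Hence such
  families are stable under products, so that \<open>c\<close> exists by superadditivity, and under pulling back
  along a map of ground sets by taking transversals of the fibres (this is where \<open>k \<ge> 3\<close> is needed).
  Replacing every point by \<open>m\<close> points gives \<open>c (m * u) \<le> c u ^ m\<close>; expanding \<open>(z + w) ^ j\<close> for each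
  complement of size \<open>j\<close> gives that \<open>(c u - 1) / u\<close> is nondecreasing. So
  \<open>(c u - 1) / u\<close> decreases to a limit \<open>\<gamma>\<close> as \<open>u \<rightarrow> 0\<close>, and \<open>ln (c u) / u\<close> has supremum \<open>\<gamma>\<close>.

  For the upper bound on \<open>lcm_free_max\<close>, split \<open>a = r\<^sup>2 m\<close> with \<open>m\<close> squarefree and regard \<open>m\<close> as a set of
  primes. Splitting each prime of weight \<open>w\<close> into about \<open>w / \<delta>\<close> points of weight \<open>\<delta> \<rightarrow> 0\<close> bounds the
  weight of a uniform family by \<open>exp (\<gamma> * \<Sum>w)\<close>, and only sizes up to \<open>e * \<Sum>w\<close> matter. For the lower
  bound, group the primes into blocks of reciprocal sum about \<open>u\<close> and take transversals of an optimal
  uniform family on the blocks.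
\<close>

section \<open>Uniform cosunflower-free families\<close>

definition fam_weight :: "('a \<Rightarrow> real) \<Rightarrow> 'a set set \<Rightarrow> real" where
  "fam_weight w F = (\<Sum>S\<in>F. \<Prod>x\<in>S. w x)"

definition uniform_free :: "nat \<Rightarrow> 'a set \<Rightarrow> 'a set set \<Rightarrow> bool" where
  "uniform_free k X F \<longleftrightarrow> F \<subseteq> Pow X \<and> cosunflower_free k F \<and> (\<exists>r. \<forall>S\<in>F. card S = r)"

definition transversals :: "('a \<Rightarrow> 'b) \<Rightarrow> 'a set \<Rightarrow> 'b set set \<Rightarrow> 'a set set" where
  "transversals p X F = {T. T \<subseteq> X \<and> inj_on p T \<and> p ` T \<in> F}"

definition joins :: "'a set set \<Rightarrow> 'a set set \<Rightarrow> 'a set set" where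
  "joins F G = (\<lambda>(S, T). S \<union> T) ` (F \<times> G)"

lemma fam_weight_const: "fam_weight (\<lambda>_. u) F = (\<Sum>S\<in>F. u ^ card S)"
  by (simp add: fam_weight_def)

lemma fam_weight_mono:
  assumes "F \<subseteq> Pow X" "\<And>x. x \<in> X \<Longrightarrow> 0 \<le> v x \<and> v x \<le> w x"
  shows "fam_weight v F \<le> fam_weight w F"
  unfolding fam_weight_def using assms by (intro sum_mono prod_mono) blast

lemma cosunflower_free_subset: "cosunflower_free k F \<Longrightarrow> G \<subseteq> F \<Longrightarrow> cosunflower_free k G"
  unfolding cosunflower_free_def by (meson subset_trans)

lemma cosunflower_freeD:
  assumes "cosunflower_free k F" "\<And>i. i \<in> {1..k} \<Longrightarrow> S i \<in> F"
    "\<And>i j. i \<in> {1..k} \<Longrightarrow> j \<in> {1..k} \<Longrightarrow> i < j \<Longrightarrow> S i \<union> S j = K"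
  shows "\<not> inj_on S {1..k}"
proof
  assume "inj_on S {1..k}"
  then have "cosunflower k S" unfolding cosunflower_def using assms(3) by auto
  moreover have "S ` {1..k} \<subseteq> F" using assms(2) by auto
  ultimately show False using assms(1) by (simp add: cosunflower_free_def)
qed

lemma cosunflower_freeI:
  assumes "\<And>S K. \<lbrakk>inj_on S {1..k}; \<And>i. i \<in> {1..k} \<Longrightarrow> S i \<in> F;
    \<And>i j. i \<in> {1..k} \<Longrightarrow> j \<in> {1..k} \<Longrightarrow> i \<noteq> j \<Longrightarrow> S i \<union> S j = K\<rbrakk> \<Longrightarrow> False"
  shows "cosunflower_free k F"
  unfolding cosunflower_free_def cosunflower_def
proof (rule notI, elim exE conjE)
  fix S K assume "S ` {1..k} \<subseteq> F" "inj_on S {1..k}"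
    and K: "\<forall>i\<in>{1..k}. \<forall>j\<in>{1..k}. i < j \<longrightarrow> S i \<union> S j = K"
  moreover have "S i \<union> S j = K" if "i \<in> {1..k}" "j \<in> {1..k}" "i \<noteq> j" for i j
    using K that by (metis linorder_neqE_nat sup_commute)
  ultimately show False using assms[of S K] by blast
qed

lemma not_inj_on_first_two:
  assumes "k \<ge> 2" "S 1 = S 2" shows "\<not> inj_on S {1..k::nat}"
proof
  assume "inj_on S {1..k}"
  from inj_onD[OF this assms(2)] assms(1) show False by simp
qed

lemma uniform_freeE:
  assumes "uniform_free k X F"
  obtains r where "F \<subseteq> Pow X" "cosunflower_free k F" "\<And>S. S \<in> F \<Longrightarrow> card S = r"
proof -
  obtain r where "\<forall>S\<in>F. card S = r" using assms by (auto simp: uniform_free_def)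
  then show ?thesis using that[of r] assms by (simp add: uniform_free_def)
qed

section \<open>Collapse, pull-back and products of uniform families\<close>

text \<open>Freeness makes the indexing non-injective, say \<open>A a = A b\<close>, so
  \<open>A a = K\<close>; every other member is contained in \<open>K\<close> and has the same
  finite size. This rigidity makes uniform families stable under pull-back and products.\<close>

lemma uniform_free_collapse:
  assumes "uniform_free k X F" "finite X"
    and A: "\<And>i. i \<in> {1..k} \<Longrightarrow> A i \<in> F"
    and K: "\<And>i j. i \<in> {1..k} \<Longrightarrow> j \<in> {1..k} \<Longrightarrow> i \<noteq> j \<Longrightarrow> A i \<union> A j = K"
    and i: "i \<in> {1..k}"
  shows "A i = K"
proof -
  obtain r where F: "F \<subseteq> Pow X" and free: "cosunflower_free k F" and r: "\<And>S. S \<in> F \<Longrightarrow> card S = r"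
    using uniform_freeE[OF assms(1)] by metis
  have K': "A i \<union> A j = K" if "i \<in> {1..k}" "j \<in> {1..k}" "i < j" for i j
    using K[OF that(1,2)] that(3) by simp
  have "\<not> inj_on A {1..k}" by (rule cosunflower_freeD[OF free A K'])
  then obtain a b where ab: "a \<in> {1..k}" "b \<in> {1..k}" "a \<noteq> b" "A a = A b"
    unfolding inj_on_def by blast
  then have Aa: "A a = K" using K[OF ab(1-3)] by simp
  have "K \<subseteq> X" using A[OF ab(1)] Aa F by blast
  then have "finite K" using assms(2) by (rule finite_subset)
  moreover have "A i \<subseteq> K"
  proof (cases "i = a")
    case False then show ?thesis using K[OF i ab(1)] by auto
  qed (simp add: Aa)
  moreover have "card (A i) = card K" using r[OF A[OF i]] r[OF A[OF ab(1)]] Aa by simp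
  ultimately show ?thesis by (simp add: card_subset_eq)
qed

text \<open>By collapse all images of the \<open>T i\<close> under \<open>p\<close> agree. A point
  \<open>x\<close> of \<open>T i\<close> outside \<open>T j\<close> then lies in \<open>T l\<close>
  for a third index \<open>l\<close>; the point \<open>y\<close> of \<open>T j\<close> in the same
  fibre lies in \<open>T i\<close> or \<open>T l\<close>, and injectivity of \<open>p\<close> there
  gives \<open>y = x\<close>, a contradiction. Hence all \<open>T i\<close> coincide.\<close>

lemma uniform_free_transversals:
  assumes "k \<ge> 3" "finite B" "uniform_free k B F"
  shows "uniform_free k X (transversals p X F)"
proof -
  obtain r where r: "\<And>S. S \<in> F \<Longrightarrow> card S = r"
    using uniform_freeE[OF assms(3)] by metis
  have "card T = r" if "T \<in> transversals p X F" for T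
  proof -
    have "inj_on p T" "p ` T \<in> F" using that by (simp_all add: transversals_def)
    then show ?thesis using r[of "p ` T"] by (simp add: card_image)
  qed
  moreover have "cosunflower_free k (transversals p X F)"
  proof (rule cosunflower_freeI)
    fix T K
    assume inj: "inj_on T {1..k}" and T: "\<And>i. i \<in> {1..k} \<Longrightarrow> T i \<in> transversals p X F"
      and K: "\<And>i j. i \<in> {1..k} \<Longrightarrow> j \<in> {1..k} \<Longrightarrow> i \<noteq> j \<Longrightarrow> T i \<union> T j = K"
    have im: "p ` T i = p ` K" if "i \<in> {1..k}" for i
    proof (rule uniform_free_collapse[OF assms(3,2) _ _ that])
      show "p ` T i \<in> F" if "i \<in> {1..k}" for i using T[OF that] by (simp add: transversals_def)
      show "p ` T i \<union> p ` T j = p ` K" if "i \<in> {1..k}" "j \<in> {1..k}" "i \<noteq> j" for i j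
        using K[OF that] by blast
    qed
    have sub: "T i \<subseteq> T j" if ij: "i \<in> {1..k}" "j \<in> {1..k}" "i \<noteq> j" for i j
    proof
      fix x assume x: "x \<in> T i"
      have "\<not> {1..k} \<subseteq> {i, j}"
      proof
        assume "{1..k} \<subseteq> {i, j}"
        then have "card {1..k} \<le> card {i, j}" by (intro card_mono) auto
        also have "card {i, j} \<le> 2" by (simp add: card_insert_if)
        finally show False using assms(1) by simp
      qed
      then obtain l where l: "l \<in> {1..k}" "l \<noteq> i" "l \<noteq> j" by blast
      have Kj: "K = T j \<union> T l" and Ki: "K = T i \<union> T l" and Kij: "K = T i \<union> T j"
        using K[OF ij(2) l(1)] K[OF ij(1) l(1)] K[OF ij] l(2,3) by simp_all
      have inj': "inj_on p (T i)" "inj_on p (T l)"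
        using T[OF ij(1)] T[OF l(1)] by (simp_all add: transversals_def)
      show "x \<in> T j"
      proof (rule ccontr)
        assume nx: "x \<notin> T j"
        then have xl: "x \<in> T l" using x Kij Kj by blast
        have "p x \<in> p ` T j" using im[OF ij(1)] im[OF ij(2)] x by blast
        then obtain y where y: "y \<in> T j" "p y = p x" by auto
        then have "y \<in> T i \<or> y \<in> T l" using Kij Ki by blast
        then have "y = x" using inj_onD[OF inj'(1) y(2) _ x] inj_onD[OF inj'(2) y(2) _ xl] by blast
        then show False using y nx by blast
      qed
    qed
    have "1 \<in> {1..k}" "2 \<in> {1..k}" using assms(1) by simp_all
    then have "T 1 = T 2" using sub[of 1 2] sub[of 2 1] by (intro equalityI) simp_all
    then show False using not_inj_on_first_two[of k T] inj assms(1) by simp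
  qed
  moreover have "transversals p X F \<subseteq> Pow X" by (auto simp: transversals_def)
  ultimately show ?thesis unfolding uniform_free_def by blast
qed

text \<open>Expanding the product over \<open>S\<close> of the fibre sums gives one term for each
  choice of a point in every fibre, that is, for each transversal lying over \<open>S\<close>; the
  terms are then regrouped by image.\<close>

lemma fam_weight_transversals:
  assumes "finite X" "finite B" "F \<subseteq> Pow B"
  shows "fam_weight w (transversals p X F) = fam_weight (\<lambda>j. \<Sum>x\<in>{x\<in>X. p x = j}. w x) F"
proof -
  let ?Y = "\<lambda>j. {x\<in>X. p x = j}"
  have "fam_weight (\<lambda>j. \<Sum>x\<in>?Y j. w x) F
      = (\<Sum>S\<in>F. \<Sum>T | T \<in> transversals p X F \<and> p ` T = S. \<Prod>x\<in>T. w x)"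
    unfolding fam_weight_def
  proof (rule sum.cong[OF refl])
    fix S assume S: "S \<in> F"
    have "S \<subseteq> B" using S assms(3) by blast
    then have fS: "finite S" using assms(2) by (rule finite_subset)
    have "(\<Prod>j\<in>S. \<Sum>x\<in>?Y j. w x) = (\<Sum>f\<in>PiE S ?Y. \<Prod>j\<in>S. w (f j))"
      using fS assms(1) by (intro prod_sum_PiE) auto
    also have "\<dots> = (\<Sum>T | T \<in> transversals p X F \<and> p ` T = S. \<Prod>x\<in>T. w x)"
    \<comment> \<open>A choice function corresponds to its range; the inverse is restricted to
      \<open>S\<close> because members of \<open>PiE\<close> are \<open>undefined\<close>
      elsewhere.\<close>
    proof (rule sum.reindex_bij_witness
        [where i = "\<lambda>T. restrict (the_inv_into T p) S" and j = "\<lambda>f. f ` S"])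
      fix f assume f: "f \<in> PiE S ?Y"
      have pf: "p (f j) = j" "f j \<in> X" if "j \<in> S" for j using PiE_mem[OF f that] by auto
      have inj: "inj_on p (f ` S)" using pf by (auto simp: inj_on_def)
      show "restrict (the_inv_into (f ` S) p) S = f"
      proof
        fix j show "restrict (the_inv_into (f ` S) p) S j = f j"
        proof (cases "j \<in> S")
          case True
          then show ?thesis using the_inv_into_f_f[OF inj, of "f j"] pf by simp
        next
          case False then show ?thesis using f by (auto simp: PiE_def extensional_def)
        qed
      qed
      have im: "p ` f ` S = S" using pf by force
      show "f ` S \<in> {T \<in> transversals p X F. p ` T = S}"
        using im inj pf S by (auto simp: transversals_def)
      have "inj_on f S" using pf by (metis inj_on_def)
      then show "(\<Prod>x\<in>f ` S. w x) = (\<Prod>j\<in>S. w (f j))" by (simp add: prod.reindex)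
    next
      fix T assume T: "T \<in> {T \<in> transversals p X F. p ` T = S}"
      then have inj: "inj_on p T" and im: "p ` T = S" and TX: "T \<subseteq> X" by (auto simp: transversals_def)
      show "restrict (the_inv_into T p) S ` S = T"
        using the_inv_into_onto[OF inj] im by simp
      show "restrict (the_inv_into T p) S \<in> PiE S ?Y"
      proof (rule PiE_I)
        fix j assume "j \<in> S"
        then show "restrict (the_inv_into T p) S j \<in> ?Y j"
          using f_the_inv_into_f[OF inj, of j] the_inv_into_into[OF inj, of j T] im TX by auto
      qed auto
    qed
    finally show "(\<Prod>j\<in>S. \<Sum>x\<in>?Y j. w x)
      = (\<Sum>T | T \<in> transversals p X F \<and> p ` T = S. \<Prod>x\<in>T. w x)" .
  qed
  also have "\<dots> = fam_weight w (transversals p X F)"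
    unfolding fam_weight_def
  proof (rule sum.group)
    show "finite (transversals p X F)"
      using assms(1) by (auto simp: transversals_def intro: finite_subset[of _ "Pow X"])
    show "finite F" using assms by (simp add: finite_subset)
  qed (auto simp: transversals_def)
  finally show ?thesis by simp
qed

text \<open>The traces on \<open>X\<close> and on \<open>Y\<close> of sets with equal pairwise
  unions again have equal pairwise unions, so each trace collapses and all \<open>S i\<close> are
  the same set. Traces may repeat, which is why collapse and not mere freeness is used.\<close>

lemma uniform_free_joins:
  assumes "k \<ge> 2" "finite X" "finite Y" "X \<inter> Y = {}" "uniform_free k X F" "uniform_free k Y G"
  shows "uniform_free k (X \<union> Y) (joins F G)"
proof -
  obtain r where r: "\<And>S. S \<in> F \<Longrightarrow> card S = r" and FX: "F \<subseteq> Pow X"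
    using uniform_freeE[OF assms(5)] by metis
  obtain s where s: "\<And>T. T \<in> G \<Longrightarrow> card T = s" and GY: "G \<subseteq> Pow Y"
    using uniform_freeE[OF assms(6)] by metis
  have split: "U \<inter> X \<in> F \<and> U \<inter> Y \<in> G \<and> U \<subseteq> X \<union> Y" if U: "U \<in> joins F G" for U
  proof -
    obtain S T where "S \<in> F" "T \<in> G" "U = S \<union> T" using U unfolding joins_def by auto
    moreover then have "S \<subseteq> X" "T \<subseteq> Y" using FX GY by auto
    ultimately have "U \<inter> X = S" "U \<inter> Y = T" "U \<subseteq> X \<union> Y" using assms(4) by auto
    then show ?thesis using \<open>S \<in> F\<close> \<open>T \<in> G\<close> by simp
  qed
  have "card U = r + s" if "U \<in> joins F G" for U
  proof -
    have "U = (U \<inter> X) \<union> (U \<inter> Y)" using split[OF that] by blast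
    moreover have "card ((U \<inter> X) \<union> (U \<inter> Y)) = card (U \<inter> X) + card (U \<inter> Y)"
      using assms(2-4) by (intro card_Un_disjoint) auto
    ultimately show ?thesis using r[of "U \<inter> X"] s[of "U \<inter> Y"] split[OF that] by simp
  qed
  moreover have "cosunflower_free k (joins F G)"
  proof (rule cosunflower_freeI)
    fix S K
    assume inj: "inj_on S {1..k}" and S: "\<And>i. i \<in> {1..k} \<Longrightarrow> S i \<in> joins F G"
      and K: "\<And>i j. i \<in> {1..k} \<Longrightarrow> j \<in> {1..k} \<Longrightarrow> i \<noteq> j \<Longrightarrow> S i \<union> S j = K"
    have SK: "S i \<inter> Z \<union> S j \<inter> Z = K \<inter> Z" if "i \<in> {1..k}" "j \<in> {1..k}" "i \<noteq> j" for i j Z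
      using K[OF that] by blast
    have "S i \<inter> X = K \<inter> X" if "i \<in> {1..k}" for i
      by (rule uniform_free_collapse[OF assms(5,2) _ SK that]) (use split[OF S] in simp_all)
    moreover have "S i \<inter> Y = K \<inter> Y" if "i \<in> {1..k}" for i
      by (rule uniform_free_collapse[OF assms(6,3) _ SK that]) (use split[OF S] in simp_all)
    ultimately have "S i = K \<inter> (X \<union> Y)" if "i \<in> {1..k}" for i
      using that split[OF S[OF that]] by blast
    then have "S 1 = S 2" using assms(1) by simp
    then show False using not_inj_on_first_two[OF assms(1)] inj by blast
  qed
  ultimately show ?thesis unfolding uniform_free_def using split by blast
qed

lemma fam_weight_joins:
  assumes "finite X" "finite Y" "X \<inter> Y = {}" "F \<subseteq> Pow X" "G \<subseteq> Pow Y"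
  shows "fam_weight w (joins F G) = fam_weight w F * fam_weight w G"
proof -
  have inj: "inj_on (\<lambda>(S, T). S \<union> T) (F \<times> G)"
  proof (rule inj_onI, clarify)
    fix S T S' T' assume *: "S \<in> F" "T \<in> G" "S' \<in> F" "T' \<in> G" "S \<union> T = S' \<union> T'"
    then have "S \<subseteq> X" "S' \<subseteq> X" "T \<subseteq> Y" "T' \<subseteq> Y" using assms by auto
    then show "S = S' \<and> T = T'" using *(5) assms(3) by blast
  qed
  have "fam_weight w (joins F G) = (\<Sum>(S, T)\<in>F \<times> G. \<Prod>x\<in>S \<union> T. w x)"
    unfolding fam_weight_def joins_def by (subst sum.reindex[OF inj]) (auto intro: sum.cong)
  also have "\<dots> = (\<Sum>(S, T)\<in>F \<times> G. (\<Prod>x\<in>S. w x) * (\<Prod>x\<in>T. w x))"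
  proof (rule sum.cong[OF refl], clarify)
    fix S T assume "S \<in> F" "T \<in> G"
    then have "S \<subseteq> X" "T \<subseteq> Y" using assms by auto
    then show "(\<Prod>x\<in>S \<union> T. w x) = (\<Prod>x\<in>S. w x) * (\<Prod>x\<in>T. w x)"
      using assms by (intro prod.union_disjoint) (auto intro: finite_subset)
  qed
  also have "\<dots> = fam_weight w F * fam_weight w G"
    unfolding fam_weight_def by (simp add: sum_product sum.cartesian_product)
  finally show ?thesis .
qed

section \<open>Maximal weight of a uniform free family\<close>

definition uniform_max :: "nat \<Rightarrow> nat \<Rightarrow> real \<Rightarrow> real" where
  "uniform_max k n u = Max {fam_weight (\<lambda>_. u) F | F. uniform_free k {1..n} F}"

text \<open>A bijection \<open>p\<close> has singleton fibres, so its transversals are the preimages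
  of members, and pull-back preserves the weight.\<close>

lemma uniform_free_relabel:
  assumes "k \<ge> 3" "finite X" "finite Y" "card X = card Y" "uniform_free k X F"
  shows "\<exists>G. uniform_free k Y G \<and> fam_weight (\<lambda>_. u) G = fam_weight (\<lambda>_. u) F"
proof -
  obtain p where p: "bij_betw p Y X"
    using finite_same_card_bij[OF assms(3,2)] assms(4) by auto
  have FX: "F \<subseteq> Pow X" using assms(5) by (simp add: uniform_free_def)
  have "(\<Sum>y\<in>{y\<in>Y. p y = x}. u) = u" if "x \<in> X" for x
  proof -
    have inj: "inj_on p Y" and im: "x \<in> p ` Y" using p that by (simp_all add: bij_betw_def)
    obtain y where y: "y \<in> Y" "p y = x" using im by auto
    have "z = y" if "z \<in> Y" "p z = x" for z
      by (rule inj_onD[OF inj _ that(1) y(1)]) (simp add: that y)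
    with y have "{y\<in>Y. p y = x} = {y}" by blast
    then show ?thesis by simp
  qed
  then have "fam_weight (\<lambda>x. \<Sum>y\<in>{y\<in>Y. p y = x}. u) F = fam_weight (\<lambda>_. u) F"
    using FX unfolding fam_weight_def by (intro sum.cong prod.cong refl) blast
  then have "fam_weight (\<lambda>_. u) (transversals p Y F) = fam_weight (\<lambda>_. u) F"
    by (simp only: fam_weight_transversals[OF assms(3,2) FX])
  then show ?thesis using uniform_free_transversals[OF assms(1,2,5)] by blast
qed

text \<open>This one-member family shows that the maxima range over nonempty sets and that
  \<open>uniform_max\<close> is at least 1.\<close>

lemma uniform_free_empty_set: "k \<ge> 2 \<Longrightarrow> uniform_free k X {{}}"
  unfolding uniform_free_def
proof (intro conjI)
  assume k: "k \<ge> 2"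
  show "cosunflower_free k {{} :: 'a set}"
  proof (rule cosunflower_freeI)
    fix S :: "nat \<Rightarrow> 'a set" and K
    assume *: "inj_on S {1..k}" "\<And>i. i \<in> {1..k} \<Longrightarrow> S i \<in> {{}}"
    have "S 1 = S 2" using *(2)[of 1] *(2)[of 2] k by simp
    then show False using not_inj_on_first_two[OF k] *(1) by blast
  qed
qed auto

lemma finite_uniform_weights: "finite {fam_weight (\<lambda>_. u) F | F. uniform_free k {1..n::nat} F}"
proof -
  have "{fam_weight (\<lambda>_. u) F | F. uniform_free k {1..n} F} \<subseteq> fam_weight (\<lambda>_. u) ` Pow (Pow {1..n})"
    by (auto simp: uniform_free_def)
  then show ?thesis by (rule finite_subset) simp
qed

lemma uniform_max_ge:
  assumes "k \<ge> 3" "finite X" "uniform_free k X F"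
  shows "fam_weight (\<lambda>_. u) F \<le> uniform_max k (card X) u"
proof -
  obtain G where "uniform_free k {1..card X} G" "fam_weight (\<lambda>_. u) G = fam_weight (\<lambda>_. u) F"
    using uniform_free_relabel[OF assms(1,2) _ _ assms(3), of "{1..card X}"] by auto
  then show ?thesis
    unfolding uniform_max_def
    by (intro Max_ge finite_uniform_weights CollectI exI[of _ G]) simp
qed

lemma uniform_max_attained:
  assumes "k \<ge> 3" "finite X"
  obtains F where "uniform_free k X F" "fam_weight (\<lambda>_. u) F = uniform_max k (card X) u"
proof -
  have "{fam_weight (\<lambda>_. u) F | F. uniform_free k {1..card X} F} \<noteq> {}"
    using uniform_free_empty_set[of k] assms by auto
  from Max_in[OF finite_uniform_weights this] obtain G
    where "uniform_free k {1..card X} G" "fam_weight (\<lambda>_. u) G = uniform_max k (card X) u"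
    unfolding uniform_max_def by auto
  then show ?thesis
    using uniform_free_relabel[OF assms(1) _ assms(2), of "{1..card X}" G u] that by auto
qed

lemma uniform_max_ge_1:
  assumes "k \<ge> 3" shows "uniform_max k n u \<ge> 1"
  using uniform_max_ge[OF assms _ uniform_free_empty_set, of "{1..n}" u] assms
  by (simp add: fam_weight_def)

lemma uniform_max_supermult:
  assumes "k \<ge> 3"
  shows "uniform_max k m u * uniform_max k n u \<le> uniform_max k (m + n) u"
proof -
  let ?X = "{1..m}" and ?Y = "{m + 1..m + n}"
  obtain F where F: "uniform_free k ?X F" "fam_weight (\<lambda>_. u) F = uniform_max k m u"
    using uniform_max_attained[OF assms, of ?X u] by auto
  obtain G where G: "uniform_free k ?Y G" "fam_weight (\<lambda>_. u) G = uniform_max k n u"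
    using uniform_max_attained[OF assms, of ?Y u] by auto
  have disj: "?X \<inter> ?Y = {}" by auto
  have "uniform_free k (?X \<union> ?Y) (joins F G)"
    using assms F G disj by (intro uniform_free_joins) auto
  moreover have "card (?X \<union> ?Y) = m + n" using disj by (subst card_Un_disjoint) auto
  moreover have "fam_weight (\<lambda>_. u) (joins F G) = uniform_max k m u * uniform_max k n u"
    using F G disj by (subst fam_weight_joins[of ?X ?Y]) (auto simp: uniform_free_def)
  ultimately show ?thesis using uniform_max_ge[OF assms, of "?X \<union> ?Y" "joins F G" u] by simp
qed

section \<open>Comparison with arbitrary free families and existence of the rate\<close>

lemma sum_Pow_prod: "finite X \<Longrightarrow> (\<Sum>S\<in>Pow X. \<Prod>x\<in>S. w x) = (\<Prod>x\<in>X. 1 + w x :: real)"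
  using prod_add[of X w "\<lambda>_. 1"] by (simp add: add.commute)

lemma fam_weight_le_prod:
  assumes "finite X" "F \<subseteq> Pow X" "\<And>x. x \<in> X \<Longrightarrow> w x \<ge> 0"
  shows "fam_weight w F \<le> (\<Prod>x\<in>X. 1 + w x)"
  unfolding fam_weight_def sum_Pow_prod[OF assms(1), symmetric]
  using assms by (intro sum_mono2 prod_nonneg) auto

text \<open>Each of the \<open>R + 1\<close> layers of fixed size is uniform and inherits freeness.
  A bound \<open>R\<close> other than \<open>card X\<close> matters for sets of primes, where the
  ground set is far too large.\<close>

lemma fam_weight_le_layers:
  assumes "finite X" "F \<subseteq> Pow X" "cosunflower_free k F" "\<And>S. S \<in> F \<Longrightarrow> card S \<le> R"
    "\<And>G. uniform_free k X G \<Longrightarrow> fam_weight w G \<le> M"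
  shows "fam_weight w F \<le> (real R + 1) * M"
proof -
  have "finite F" using assms(1,2) by (simp add: finite_subset)
  then have "fam_weight w F = (\<Sum>r\<in>{0..R}. fam_weight w {S\<in>F. card S = r})"
    unfolding fam_weight_def using assms(4) by (subst sum.group) auto
  also have "\<dots> \<le> (\<Sum>r\<in>{0..R}. M)"
  proof (intro sum_mono assms(5))
    fix r show "uniform_free k X {S\<in>F. card S = r}"
      using assms cosunflower_free_subset[of k F "{S\<in>F. card S = r}"]
      by (auto simp: uniform_free_def)
  qed
  finally show ?thesis by (simp add: algebra_simps)
qed

lemma fam_weight_le_uniform_max:
  assumes "k \<ge> 3" "finite X" "F \<subseteq> Pow X" "cosunflower_free k F"
  shows "fam_weight (\<lambda>_. u) F \<le> (real (card X) + 1) * uniform_max k (card X) u"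
  using assms uniform_max_ge[OF assms(1,2)]
  by (intro fam_weight_le_layers[where X = X]) (auto intro: card_mono)

text \<open>Fekete's lemma; the limit is the supremum of the quotients \<open>a n / real n\<close>,
  which also yields a bound valid for every \<open>n\<close>.\<close>

lemma superadditive_limit:
  fixes a :: "nat \<Rightarrow> real"
  assumes sup: "\<And>m n. a m + a n \<le> a (m + n)" and nonneg: "\<And>n. a n \<ge> 0"
    and bound: "\<And>n. a n \<le> C * real n"
  obtains l where "(\<lambda>n. a n / real n) \<longlonglongrightarrow> l" "\<And>n. a n \<le> l * real n"
proof
  define l where "l = (SUP n\<in>{1..}. a n / real n)"
  have bdd: "bdd_above ((\<lambda>n. a n / real n) ` {1..})"
    using bound by (intro bdd_aboveI[of _ C]) (auto simp: field_simps)
  have le: "a n / real n \<le> l" if "n \<ge> 1" for n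
    unfolding l_def using that by (intro cSUP_upper bdd) auto
  have a0: "a 0 = 0" using sup[of 0 0] nonneg[of 0] by simp
  then show "a n \<le> l * real n" for n using le[of n] by (cases "n = 0") (auto simp: field_simps)
  have mult: "real q * a m \<le> a (q * m)" for q m
  proof (induction q)
    case (Suc q) then show ?case using sup[of m "q * m"] by (simp add: algebra_simps)
  qed (simp add: nonneg)
  show "(\<lambda>n. a n / real n) \<longlonglongrightarrow> l"
  proof (rule order_tendstoI)
    fix y assume "y < l"
    then obtain m where m: "m \<ge> 1" "y < a m / real m"
      unfolding l_def using less_cSUP_iff[OF _ bdd, of y] by auto
    \<comment> \<open>With \<open>n = q * m + r\<close> and \<open>r < m\<close>, superadditivity
      gives that \<open>a n\<close> is at least \<open>q * a m\<close>, hence at least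
      \<open>(n - m) * (a m / m)\<close>. After division by \<open>n\<close> this lower bound tends
      to \<open>a m / m\<close>, which exceeds \<open>y\<close>.\<close>
    have *: "(\<lambda>n. (1 - real m / real n) * (a m / real m)) \<longlonglongrightarrow> (1 - 0) * (a m / real m)"
      by (intro tendsto_intros lim_const_over_n)
    then have "\<forall>\<^sub>F n in sequentially. y < (1 - real m / real n) * (a m / real m)"
      using m by (intro order_tendstoD(1)[OF *]) auto
    then show "\<forall>\<^sub>F n in sequentially. y < a n / real n"
      using eventually_gt_at_top[of 0]
    proof eventually_elim
      case (elim n)
      have n: "n = (n div m) * m + n mod m" by simp
      have "real n - real m \<le> real (n div m * m)"
      proof -
        have "n \<le> n div m * m + m"
          using m mod_less_divisor[of m n] div_mult_mod_eq[of n m] by linarith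
        then have "real n \<le> real (n div m * m + m)" by (simp only: of_nat_le_iff)
        then show ?thesis by simp
      qed
      then have "(real n - real m) * (a m / real m) \<le> real (n div m * m) * (a m / real m)"
        using nonneg by (intro mult_right_mono) auto
      also have "\<dots> = real (n div m) * a m" using m by simp
      also have "\<dots> \<le> a (n div m * m)" by (rule mult)
      also have "\<dots> \<le> a n" using sup[of "n div m * m" "n mod m"] nonneg[of "n mod m"] by simp
      finally have "(real n - real m) * (a m / real m) / real n \<le> a n / real n"
        using elim by (intro divide_right_mono) auto
      moreover have "(real n - real m) * (a m / real m) / real n = (1 - real m / real n) * (a m / real m)"
        using elim by (simp add: field_simps)
      ultimately show ?case using elim by linarith
    qed
  next
    fix y assume "l < y"
    then show "\<forall>\<^sub>F n in sequentially. a n / real n < y"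
      by (intro eventually_mono[OF eventually_ge_at_top[of 1]] le_less_trans[OF le])
  qed
qed

lemma uniform_max_le: 
  assumes "k \<ge> 3" "u \<ge> 0" shows "uniform_max k n u \<le> (1 + u) ^ n"
proof -
  obtain F where F: "uniform_free k {1..n} F" "fam_weight (\<lambda>_. u) F = uniform_max k n u"
    using uniform_max_attained[OF assms(1), of "{1..n}" u] by auto
  then show ?thesis
    using fam_weight_le_prod[of "{1..n}" F "\<lambda>_. u"] assms by (auto simp: uniform_free_def)
qed

lemma finite_cosunflower_weights:
  "finite {\<Sum>S\<in>G. u ^ card S | G. G \<subseteq> Pow {1..n::nat} \<and> cosunflower_free k G}" for u :: real
proof -
  have "{\<Sum>S\<in>G. u ^ card S | G. G \<subseteq> Pow {1..n} \<and> cosunflower_free k G} 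
     \<subseteq> (\<lambda>G. \<Sum>S\<in>G. u ^ card S) ` Pow (Pow {1..n})" by auto
  then show ?thesis by (rule finite_subset) simp
qed

lemma cosunflower_weight_bounds:
  assumes "k \<ge> 3"
  shows "uniform_max k n u \<le> cosunflower_weight k n u"
    "cosunflower_weight k n u \<le> (real n + 1) * uniform_max k n u"
proof -
  obtain F where F: "uniform_free k {1..n} F" "fam_weight (\<lambda>_. u) F = uniform_max k n u"
    using uniform_max_attained[OF assms(1), of "{1..n}" u] by auto
  then show "uniform_max k n u \<le> cosunflower_weight k n u"
    unfolding cosunflower_weight_def F(2)[symmetric] fam_weight_const
    by (intro Max_ge finite_cosunflower_weights CollectI exI[of _ F]) (simp add: uniform_free_def)
  have "cosunflower_weight k n u \<in> {\<Sum>S\<in>G. u ^ card S | G. G \<subseteq> Pow {1..n} \<and> cosunflower_free k G}"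
    unfolding cosunflower_weight_def
    using F(1) by (intro Max_in finite_cosunflower_weights) (auto simp: uniform_free_def)
  then obtain G where "cosunflower_weight k n u = fam_weight (\<lambda>_. u) G"
    "G \<subseteq> Pow {1..n}" "cosunflower_free k G"
    unfolding fam_weight_const by auto
  then show "cosunflower_weight k n u \<le> (real n + 1) * uniform_max k n u"
    using fam_weight_le_uniform_max[OF assms, of "{1..n}" G u] by simp
qed

text \<open>Fekete's lemma applies to \<open>ln (uniform_max k n u)\<close>; the factor
  \<open>n + 1\<close> between \<open>uniform_max\<close> and \<open>cosunflower_weight\<close>
  disappears in the n-th root, so both have the same rate. Since the limit is a supremum,
  \<open>c ^ n\<close> bounds every finite stage.\<close>

lemma cosunflower_rate_properties:
  assumes k: "k \<ge> 3" and u: "u > 0"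
  defines "c \<equiv> cosunflower_rate k u"
  shows cosunflower_rate_limit: "(\<lambda>n. root n (cosunflower_weight k n u)) \<longlonglongrightarrow> c"
    and ln_uniform_max_limit: "(\<lambda>n. ln (uniform_max k n u) / real n) \<longlonglongrightarrow> ln c"
    and uniform_max_le_rate: "uniform_max k n u \<le> c ^ n"
    and cosunflower_rate_ge_1: "c \<ge> 1"
proof -
  let ?U = "\<lambda>n. uniform_max k n u" and ?C = "\<lambda>n. cosunflower_weight k n u"
  have U1: "?U n \<ge> 1" for n by (rule uniform_max_ge_1[OF k])
  have "ln (?U m) + ln (?U n) \<le> ln (?U (m + n))" for m n
  proof -
    have "ln (?U m) + ln (?U n) = ln (?U m * ?U n)" 
      using U1[of m] U1[of n] by (simp add: ln_mult)
    also have "\<dots> \<le> ln (?U (m + n))"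
      using uniform_max_supermult[OF k] U1[of m] U1[of n] U1[of "m + n"] by (subst ln_le_cancel_iff) (auto intro: mult_pos_pos)
    finally show ?thesis .
  qed
  moreover have bd: "ln (?U n) \<le> ln (1 + u) * real n" for n
  proof -
    have "ln (?U n) \<le> ln ((1 + u) ^ n)"
      using uniform_max_le[OF k, of u n] U1[of n] u by (subst ln_le_cancel_iff) auto
    then show ?thesis using u by (simp add: ln_realpow mult.commute)
  qed
  ultimately obtain l where l: "(\<lambda>n. ln (?U n) / real n) \<longlonglongrightarrow> l"
    and le: "\<And>n. ln (?U n) \<le> l * real n"
    using superadditive_limit[of "\<lambda>n. ln (?U n)" "ln (1 + u)"] U1 by (metis ln_ge_zero)
  have up: "(\<lambda>n. ln (?U n) / real n + ln (real n + 1) / real n) \<longlonglongrightarrow> l + 0"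
  proof (intro tendsto_add l)
    show "(\<lambda>n. ln (real n + 1) / real n) \<longlonglongrightarrow> 0"
      by real_asymp
  qed
  have C1: "?C n \<ge> 1" for n using cosunflower_weight_bounds(1)[OF k, of n u] U1[of n] by linarith
  have "(\<lambda>n. ln (?C n) / real n) \<longlonglongrightarrow> l"
  proof (rule tendsto_sandwich[OF _ _ l up[simplified]])
    show "\<forall>\<^sub>F n in sequentially. ln (?U n) / real n \<le> ln (?C n) / real n"
    proof (rule always_eventually, rule allI, rule divide_right_mono)
      fix n show "ln (?U n) \<le> ln (?C n)"
        using cosunflower_weight_bounds(1)[OF k, of n u] U1[of n] by (subst ln_le_cancel_iff) auto
    qed simp
    show "\<forall>\<^sub>F n in sequentially. ln (?C n) / real n \<le> ln (?U n) / real n + ln (real n + 1) / real n"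
    proof (rule always_eventually, rule allI, unfold add_divide_distrib[symmetric], rule divide_right_mono)
      fix n have "ln (?C n) \<le> ln ((real n + 1) * ?U n)"
        using cosunflower_weight_bounds(2)[OF k, of n u] C1[of n] by (subst ln_le_cancel_iff) auto
      then show "ln (?C n) \<le> ln (?U n) + ln (real n + 1)" using U1[of n] by (simp add: ln_mult)
    qed simp
  qed
  then have "(\<lambda>n. exp (ln (?C n) / real n)) \<longlonglongrightarrow> exp l" by (intro tendsto_intros)
  moreover have "\<forall>\<^sub>F n in sequentially. exp (ln (?C n) / real n) = root n (?C n)"
    using eventually_gt_at_top[of 0]
  proof eventually_elim
    case (elim n)
    have "(exp (ln (?C n) / real n)) ^ n = ?C n"
      using elim C1[of n] by (simp add: exp_of_nat_mult[symmetric])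
    then show ?case using elim by (metis exp_ge_zero real_root_power_cancel)
  qed
  ultimately have lim: "(\<lambda>n. root n (?C n)) \<longlonglongrightarrow> exp l" using tendsto_cong by fast
  then have c: "c = exp l" unfolding c_def cosunflower_rate_def by (rule limI)
  show "(\<lambda>n. root n (?C n)) \<longlonglongrightarrow> c" using lim c by simp
  show "(\<lambda>n. ln (?U n) / real n) \<longlonglongrightarrow> ln c" using l c by simp
  show "?U n \<le> c ^ n"
    using le[of n] U1[of n] unfolding c exp_of_nat_mult[symmetric]
    by (metis exp_le_cancel_iff exp_ln less_le_trans mult.commute zero_less_one)
  have "l \<ge> 0" using order_trans[OF ln_ge_zero[OF U1[of 1]] le[of 1]] by simp
  then show "c \<ge> 1" using c by simp
qed

section \<open>The exponent of the cosunflower rate\<close>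

lemma cosunflower_rate_leI:
  assumes "k \<ge> 3" "u > 0" "B > 0" "\<And>n. uniform_max k n u \<le> B ^ n"
  shows "cosunflower_rate k u \<le> B"
proof -
  have "ln (uniform_max k n u) / real n \<le> ln B" if "n \<ge> 1" for n
  proof -
    have "ln (uniform_max k n u) \<le> ln (B ^ n)"
      using assms uniform_max_ge_1[OF assms(1), of n u] by (subst ln_le_cancel_iff) auto
    then show ?thesis using assms that by (simp add: ln_realpow field_simps)
  qed
  then have "ln (cosunflower_rate k u) \<le> ln B"
    by (intro LIMSEQ_le_const2[OF ln_uniform_max_limit[OF assms(1,2)]]) auto
  then show ?thesis using cosunflower_rate_ge_1[OF assms(1,2)] assms(3) by simp
qed

lemma fam_weight_le_rate_power:
  assumes "k \<ge> 3" "u > 0" "finite X" "uniform_free k X F"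
  shows "fam_weight (\<lambda>_. u) F \<le> cosunflower_rate k u ^ card X"
  using uniform_max_ge[OF assms(1,3,4), of u] uniform_max_le_rate[OF assms(1,2), of "card X"]
  by linarith

text \<open>Each \<open>x\<close> is replaced by \<open>m x\<close> copies of weight
  \<open>u\<close>, so the fibres of \<open>fst\<close> have weight \<open>m x * u\<close>. The
  pull-back is again uniform and free, and the bound for constant weight applies to it.\<close>

lemma fam_weight_blowup_le:
  assumes "k \<ge> 3" "u > 0" "finite X" "uniform_free k X F"
  shows "fam_weight (\<lambda>x. real (m x) * u) F \<le> cosunflower_rate k u ^ (\<Sum>x\<in>X. m x)"
proof -
  let ?Y = "SIGMA x:X. {..<m x}"
  have FX: "F \<subseteq> Pow X" using assms(4) by (simp add: uniform_free_def)
  have fin: "finite ?Y" using assms(3) by simp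
  have "(\<Sum>y\<in>{y\<in>?Y. fst y = x}. u) = real (m x) * u" if "x \<in> X" for x
  proof -
    have "{y\<in>?Y. fst y = x} = Pair x ` {..<m x}" using that by auto
    then show ?thesis by (simp add: card_image inj_on_def)
  qed
  then have "fam_weight (\<lambda>x. real (m x) * u) F = fam_weight (\<lambda>x. \<Sum>y\<in>{y\<in>?Y. fst y = x}. u) F"
    using FX unfolding fam_weight_def by (intro sum.cong prod.cong refl) (metis PowD subsetD)
  also have "\<dots> = fam_weight (\<lambda>_. u) (transversals fst ?Y F)"
    by (rule fam_weight_transversals[OF fin assms(3) FX, symmetric])
  also have "\<dots> \<le> cosunflower_rate k u ^ card ?Y"
    using assms fin by (intro fam_weight_le_rate_power uniform_free_transversals) auto
  finally show ?thesis using assms(3) by simp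
qed

text \<open>Blow-up with constant multiplicity \<open>m\<close> turns \<open>n\<close> points of
  weight \<open>m * u\<close> into \<open>m * n\<close> points of weight \<open>u\<close>.\<close>

lemma cosunflower_rate_mult_le:
  assumes "k \<ge> 3" "u > 0" "m \<ge> 1"
  shows "cosunflower_rate k (real m * u) \<le> cosunflower_rate k u ^ m"
proof (rule cosunflower_rate_leI)
  show "uniform_max k n (real m * u) \<le> (cosunflower_rate k u ^ m) ^ n" for n
  proof -
    obtain F where F: "uniform_free k {1..n} F" 
      "fam_weight (\<lambda>_. real m * u) F = uniform_max k n (real m * u)"
      using uniform_max_attained[OF assms(1), of "{1..n}" "real m * u"] by auto
    show ?thesis
      using fam_weight_blowup_le[OF assms(1,2) _ F(1), of "\<lambda>_. m"] F(2)
      by (simp add: power_mult[symmetric] mult.commute)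
  qed
  show "cosunflower_rate k u ^ m > 0" using cosunflower_rate_ge_1[OF assms(1,2)] by simp
qed (use assms in auto)

text \<open>In terms of \<open>z = 1 / u\<close> and \<open>\<Lambda> z = z * c (1 / z)\<close> the
  claim is that \<open>\<Lambda> z - z\<close> does not increase when \<open>z\<close> grows by
  \<open>w\<close>. Every point outside a member contributes \<open>w + z\<close>; fixing the set
  \<open>D\<close> of points that contribute \<open>w\<close> leaves a free family on the remaining
  points, where the rate at \<open>u\<close> applies.\<close>

lemma cosunflower_rate_slope_mono:
  assumes k: "k \<ge> 3" and v: "0 < v" "v \<le> u"
  shows "(cosunflower_rate k v - 1) / v \<le> (cosunflower_rate k u - 1) / u"
proof -
  define z where "z = 1 / u"
  define w where "w = 1 / v - 1 / u"
  let ?c = "cosunflower_rate k u"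
  have u: "u > 0" and z: "z > 0" and w: "w \<ge> 0" and wz: "w + z = 1 / v"
    using v by (auto simp: z_def w_def frac_le)
  have c: "?c \<ge> 1" by (rule cosunflower_rate_ge_1[OF k u])
  have "cosunflower_rate k v \<le> v * (w + z * ?c)"
  proof (rule cosunflower_rate_leI[OF k v(1)])
    show "v * (w + z * ?c) > 0" using v w z c by (intro mult_pos_pos add_nonneg_pos) auto
    fix n :: nat
    let ?X = "{1..n}"
    obtain F where F: "uniform_free k ?X F" "fam_weight (\<lambda>_. v) F = uniform_max k n v"
      using uniform_max_attained[OF k, of ?X v] by auto
    have FX: "F \<subseteq> Pow ?X" using F(1) by (simp add: uniform_free_def)
    have finF: "finite F" using FX by (simp add: finite_subset)
    \<comment> \<open>Multiplied by \<open>(1 / v) ^ n\<close>, a member carries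
      \<open>1 / v = w + z\<close> for each point outside it; \<open>D\<close> collects the points
      from which \<open>w\<close> is taken.\<close>
    have expand: "(1 / v) ^ n * v ^ card S
        = (\<Sum>D | D \<in> Pow ?X \<and> S \<subseteq> ?X - D. w ^ card D * z ^ (card (?X - D) - card S))" if "S \<in> F" for S
    proof -
      have S: "S \<subseteq> ?X" using FX that by auto
      then have fS: "finite S" and cS: "card S \<le> n" using finite_subset card_mono[OF _ S] by auto
      have "(1 / v) ^ n * v ^ card S = (1 / v) ^ (n - card S)"
        using v cS by (simp add: power_diff field_simps)
      also have "\<dots> = (\<Prod>x\<in>?X - S. w + z)" using S fS by (simp add: wz card_Diff_subset)
      also have "\<dots> = (\<Sum>D\<in>Pow (?X - S). w ^ card D * z ^ card (?X - S - D))"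
        by (subst prod_add) simp_all
      also have "\<dots> = (\<Sum>D | D \<in> Pow ?X \<and> S \<subseteq> ?X - D. w ^ card D * z ^ (card (?X - D) - card S))"
      proof (rule sum.cong)
        show "Pow (?X - S) = {D. D \<in> Pow ?X \<and> S \<subseteq> ?X - D}" using S by auto
        fix D assume D: "D \<in> {D. D \<in> Pow ?X \<and> S \<subseteq> ?X - D}"
        have "?X - S - D = (?X - D) - S" by auto
        then have "card (?X - S - D) = card (?X - D) - card S"
          using D fS by (simp add: card_Diff_subset)
        then show "w ^ card D * z ^ card (?X - S - D) = w ^ card D * z ^ (card (?X - D) - card S)"
          by simp
      qed
      finally show ?thesis .
    qed
    \<comment> \<open>For fixed \<open>D\<close> the members avoiding \<open>D\<close> form a
      uniform free family on the other points, and \<open>z = 1 / u\<close> turns a factor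
      \<open>z\<close> per point outside the member into a factor \<open>u\<close> per point
      inside.\<close>
    have inner: "(\<Sum>S | S \<in> F \<and> S \<subseteq> ?X - D. z ^ (card (?X - D) - card S)) \<le> (z * ?c) ^ card (?X - D)"
      if "D \<in> Pow ?X" for D
    proof -
      let ?F = "{S. S \<in> F \<and> S \<subseteq> ?X - D}"
      have free: "uniform_free k (?X - D) ?F"
        using F(1) cosunflower_free_subset[of k F ?F] unfolding uniform_free_def by auto
      have "(\<Sum>S\<in>?F. z ^ (card (?X - D) - card S)) = (\<Sum>S\<in>?F. z ^ card (?X - D) * u ^ card S)"
      proof (rule sum.cong[OF refl])
        fix S assume "S \<in> ?F"
        then have "card S \<le> card (?X - D)" by (intro card_mono) auto
        then show "z ^ (card (?X - D) - card S) = z ^ card (?X - D) * u ^ card S"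
          using u by (simp add: z_def power_diff field_simps)
      qed
      also have "\<dots> = z ^ card (?X - D) * fam_weight (\<lambda>_. u) ?F"
        by (simp add: fam_weight_const sum_distrib_left)
      also have "\<dots> \<le> z ^ card (?X - D) * ?c ^ card (?X - D)"
        using z fam_weight_le_rate_power[OF k u _ free] by (intro mult_left_mono) auto
      finally show ?thesis by (simp add: power_mult_distrib)
    qed
    have "(1 / v) ^ n * uniform_max k n v
        = (\<Sum>S\<in>F. \<Sum>D | D \<in> Pow ?X \<and> S \<subseteq> ?X - D. w ^ card D * z ^ (card (?X - D) - card S))"
      unfolding F(2)[symmetric] fam_weight_const sum_distrib_left using expand by simp
    also have "\<dots> = (\<Sum>D\<in>Pow ?X. \<Sum>S | S \<in> F \<and> S \<subseteq> ?X - D. w ^ card D * z ^ (card (?X - D) - card S))"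
      using finF by (intro sum.swap_restrict) auto
    also have "\<dots> \<le> (\<Sum>D\<in>Pow ?X. w ^ card D * (z * ?c) ^ card (?X - D))"
      unfolding sum_distrib_left[symmetric] using inner w
      by (intro sum_mono mult_left_mono) auto
    also have "\<dots> = (w + z * ?c) ^ n"
      using prod_add[of ?X "\<lambda>_. w" "\<lambda>_. z * ?c"] by simp
    finally show "uniform_max k n v \<le> (v * (w + z * ?c)) ^ n"
      using v by (simp add: power_one_over pos_divide_le_eq power_mult_distrib mult.commute)
  qed
  then have "cosunflower_rate k v / v \<le> w + z * ?c"
    using v by (simp add: pos_divide_le_eq mult.commute)
  then show ?thesis by (simp add: z_def w_def diff_divide_distrib)
qed

text \<open>\<open>g\<close> is the infimum of the slopes \<open>(c u - 1) / u\<close>, and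
  monotonicity makes it their limit at 0. Blow-up gives
  \<open>ln (c u) / u \<le> ln (c (u / m)) / (u / m)\<close>, which is at most the slope at
  \<open>u / m\<close>, so the limit in \<open>m\<close> bounds it by \<open>g\<close>. Conversely
  \<open>c u \<ge> 1 + g * u\<close> gives the matching lower bound near 0.\<close>

lemma cosunflower_exponent_exists:
  assumes k: "k \<ge> 3"
  obtains g where "g \<ge> 0"
    "\<And>u. u > 0 \<Longrightarrow> g \<le> (cosunflower_rate k u - 1) / u"
    "\<And>u. u > 0 \<Longrightarrow> ln (cosunflower_rate k u) / u \<le> g"
    "((\<lambda>u. (cosunflower_rate k u - 1) / u) \<longlongrightarrow> g) (at_right 0)"
    "((\<lambda>u. ln (cosunflower_rate k u) / u) \<longlongrightarrow> g) (at_right 0)"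
proof
  let ?c = "cosunflower_rate k"
  let ?h = "\<lambda>u. (?c u - 1) / u"
  define g where "g = (INF u\<in>{0<..}. ?h u)"
  have c1: "?c u \<ge> 1" if "u > 0" for u by (rule cosunflower_rate_ge_1[OF k that])
  have bdd: "bdd_below (?h ` {0<..})"
    using c1 by (intro bdd_belowI[of _ 0]) auto
  show g0: "g \<ge> 0" unfolding g_def using c1 by (intro cINF_greatest) auto
  show gh: "g \<le> ?h u" if "u > 0" for u
    unfolding g_def using that by (intro cINF_lower bdd) auto
  show lim: "(?h \<longlongrightarrow> g) (at_right 0)"
  proof (rule order_tendstoI)
    fix y assume "y < g"
    then show "\<forall>\<^sub>F u in at_right 0. y < ?h u"
      using gh by (intro eventually_at_rightI[of 0 1]) (auto intro: less_le_trans)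
  next
    fix y assume "g < y"
    then obtain u where u: "u > 0" "?h u < y"
      unfolding g_def using cINF_less_iff[OF _ bdd, of y] by auto
    then show "\<forall>\<^sub>F u in at_right 0. ?h u < y"
      by (intro eventually_at_rightI[of 0 u] le_less_trans[OF cosunflower_rate_slope_mono[OF k] u(2)])
        auto
  qed
  have lnh: "ln (?c u) / u \<le> ?h u" if "u > 0" for u
    using that c1[OF that] by (intro divide_right_mono ln_le_minus_one) auto
  show up: "ln (?c u) / u \<le> g" if u: "u > 0" for u
  proof (rule LIMSEQ_le_const)
    have "filterlim (\<lambda>m. u / real (Suc m)) (at_right 0) sequentially"
      using u LIMSEQ_Suc[OF lim_const_over_n[of u]]
      by (intro tendsto_imp_filterlim_at_right always_eventually) (auto simp del: of_nat_Suc)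
    then show "(\<lambda>m. ?h (u / real (Suc m))) \<longlonglongrightarrow> g" by (rule filterlim_compose[OF lim])
    have "ln (?c u) / u \<le> ?h (u / real (Suc m))" for m
    proof -
      let ?u = "u / real (Suc m)"
      have u': "?u > 0" using u by simp
      have "ln (?c (real (Suc m) * ?u)) \<le> ln (?c ?u ^ Suc m)"
        using cosunflower_rate_mult_le[OF k u', of "Suc m"] c1[of "real (Suc m) * ?u"] c1[OF u'] u u'
        by (subst ln_le_cancel_iff) (auto simp del: of_nat_Suc power_Suc)
      then have "ln (?c u) \<le> real (Suc m) * ln (?c ?u)"
        using c1[OF u'] by (simp add: ln_realpow del: of_nat_Suc power_Suc)
      then have "ln (?c u) / u \<le> ln (?c ?u) / ?u"
        using u by (simp add: field_simps del: of_nat_Suc)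
      then show ?thesis using lnh[OF u'] by linarith
    qed
    then show "\<exists>N. \<forall>m\<ge>N. ln (?c u) / u \<le> ?h (u / real (Suc m))" by blast
  qed
  have low: "ln (1 + g * u) / u \<le> ln (?c u) / u" if "u > 0" for u
  proof (rule divide_right_mono)
    have "1 + g * u \<le> ?c u" using gh[OF that] that by (simp add: field_simps)
    then show "ln (1 + g * u) \<le> ln (?c u)" using g0 that c1[OF that] by (subst ln_le_cancel_iff) (auto intro: add_pos_nonneg)
  qed (use that in simp)
  have lower_lim: "((\<lambda>u. ln (1 + g * u) / u) \<longlongrightarrow> g) (at_right 0)"
  \<comment> \<open>The asymptotics of \<open>ln (1 + g * u)\<close> depend on the sign of
    \<open>g\<close>; for \<open>g = 0\<close> the function is constantly 0.\<close>
  proof (cases "g = 0")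
    case False
    then have "g > 0" using g0 by simp
    then show ?thesis by real_asymp
  qed simp
  show "((\<lambda>u. ln (?c u) / u) \<longlongrightarrow> g) (at_right 0)"
    by (rule tendsto_sandwich[OF _ _ lower_lim tendsto_const])
      (auto intro!: eventually_at_rightI[of 0 1] low up)
qed

section \<open>Complementation between sunflowers and cosunflowers\<close>

lemma sunflower_free_complements:
  assumes "F \<subseteq> Pow X"
  shows "cosunflower_free k ((\<lambda>S. X - S) ` F) \<longleftrightarrow> sunflower_free k F"
proof
  let ?G = "(\<lambda>S. X - S) ` F"
  have inv: "X - (X - S) = S" if "S \<in> F" for S using that assms by auto
  { assume free: "cosunflower_free k ?G"
    show "sunflower_free k F"
      unfolding sunflower_free_def
    proof (rule notI, elim exE conjE)
      fix S assume S: "S ` {1..k} \<subseteq> F" and sun: "sunflower k S"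
      let ?T = "\<lambda>i. X - S i"
      obtain K where inj: "inj_on S {1..k}"
        and K: "\<forall>i\<in>{1..k}. \<forall>j\<in>{1..k}. i < j \<longrightarrow> S i \<inter> S j = K"
        using sun unfolding sunflower_def by blast
      have "inj_on ?T {1..k}"
        using inv S inj unfolding inj_on_def by (metis image_subset_iff)
      moreover have "?T i \<union> ?T j = X - K" if "i \<in> {1..k}" "j \<in> {1..k}" "i < j" for i j
      proof -
        have "S i \<inter> S j = K" using K that by simp
        then show ?thesis by auto
      qed
      ultimately show False
        using cosunflower_freeD[OF free, of ?T "X - K"] S by blast
    qed }
  { assume free: "sunflower_free k F"
    show "cosunflower_free k ?G"
    proof (rule cosunflower_freeI)
      fix T K assume inj: "inj_on T {1..k}" and T: "\<And>i. i \<in> {1..k} \<Longrightarrow> T i \<in> ?G"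
        and K: "\<And>i j. i \<in> {1..k} \<Longrightarrow> j \<in> {1..k} \<Longrightarrow> i \<noteq> j \<Longrightarrow> T i \<union> T j = K"
      let ?S = "\<lambda>i. X - T i"
      have SF: "?S i \<in> F" and T': "T i = X - ?S i" if "i \<in> {1..k}" for i
        using T[OF that] inv by auto
      have "inj_on ?S {1..k}" using inj T' unfolding inj_on_def by metis
      moreover have "?S i \<inter> ?S j = X - K" if "i \<in> {1..k}" "j \<in> {1..k}" "i < j" for i j
        using K[of i j] that by auto
      ultimately have "sunflower k ?S" unfolding sunflower_def by auto
      moreover have "?S ` {1..k} \<subseteq> F" using SF by auto
      ultimately show False using free by (simp add: sunflower_free_def)
    qed }
qed

text \<open>The complement of \<open>S\<close> has weight
  \<open>z ^ (n - card S) = z ^ n * (1 / z) ^ card S\<close>, so complementing all members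
  multiplies the weight of a family at \<open>1 / z\<close> by \<open>z ^ n\<close>.\<close>

lemma sunflower_weight_eq:
  assumes "k \<ge> 3" "z > 0"
  shows "sunflower_weight k n z = z ^ n * cosunflower_weight k n (1 / z)"
proof -
  let ?X = "{1..n}"
  let ?c = "\<lambda>F. (\<lambda>S. ?X - S) ` F"
  let ?A = "{F. F \<subseteq> Pow ?X \<and> sunflower_free k F}" and ?B = "{G. G \<subseteq> Pow ?X \<and> cosunflower_free k G}"
  have inv: "?c (?c F) = F" if "F \<subseteq> Pow ?X" for F
  proof -
    have "?c (?c F) = (\<lambda>S. S) ` F" unfolding image_image using that by (intro image_cong) auto
    then show ?thesis by simp
  qed
  have AB: "?c ` ?B = ?A"
  proof (intro equalityI subsetI)
    fix F assume "F \<in> ?c ` ?B"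
    then obtain G where G: "G \<subseteq> Pow ?X" "cosunflower_free k G" "F = ?c G" by auto
    then show "F \<in> ?A"
      using sunflower_free_complements[of F ?X k] inv[of G] by auto
  next
    fix F assume F: "F \<in> ?A"
    then have "?c F \<in> ?B" using sunflower_free_complements[of F ?X k] by auto
    moreover have "F = ?c (?c F)" using inv F by auto
    ultimately show "F \<in> ?c ` ?B" by blast
  qed
  moreover have "(\<Sum>S\<in>?c G. z ^ card S) = z ^ n * (\<Sum>S\<in>G. (1 / z) ^ card S)" if "G \<in> ?B" for G
  proof -
    have sub: "S \<subseteq> ?X" if "S \<in> G" for S using that \<open>G \<in> ?B\<close> by auto
    have "inj_on (\<lambda>S. ?X - S) G" by (rule inj_onI) (use sub in blast)
    then have "(\<Sum>S\<in>?c G. z ^ card S) = (\<Sum>S\<in>G. z ^ card (?X - S))" by (simp add: sum.reindex)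
    also have "\<dots> = (\<Sum>S\<in>G. z ^ n * (1 / z) ^ card S)"
    proof (rule sum.cong[OF refl])
      fix S assume "S \<in> G"
      then have S: "S \<subseteq> ?X" by (rule sub)
      then have "finite S" "card S \<le> n" using finite_subset card_mono[OF _ S] by auto
      then show "z ^ card (?X - S) = z ^ n * (1 / z) ^ card S"
        using S assms by (simp add: card_Diff_subset power_diff field_simps)
    qed
    finally show ?thesis by (simp add: sum_distrib_left)
  qed
  ultimately have "{\<Sum>S\<in>F. z ^ card S | F. F \<subseteq> Pow ?X \<and> sunflower_free k F}
      = (\<lambda>x. z ^ n * x) ` {\<Sum>S\<in>G. (1 / z) ^ card S | G. G \<subseteq> Pow ?X \<and> cosunflower_free k G}"
    unfolding setcompr_eq_image image_image by (metis (mono_tags, lifting) image_cong image_image)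
  moreover have "{\<Sum>S\<in>G. (1 / z) ^ card S | G. G \<subseteq> Pow ?X \<and> cosunflower_free k G} \<noteq> {}"
    using uniform_free_empty_set[of k ?X] assms by (auto simp: uniform_free_def)
  moreover have "mono (\<lambda>x. z ^ n * x)" using assms by (intro monoI mult_left_mono) auto
  ultimately show ?thesis
    unfolding sunflower_weight_def cosunflower_weight_def
    using finite_cosunflower_weights[of "1 / z" n k]
    by (simp add: mono_Max_commute)
qed

lemma sunflower_rate_eq:
  assumes "k \<ge> 3" "z > 0"
  shows "sunflower_rate k z = z * cosunflower_rate k (1 / z)"
  unfolding sunflower_rate_def
proof (rule limI)
  have "(\<lambda>n. z * root n (cosunflower_weight k n (1 / z))) \<longlonglongrightarrow> z * cosunflower_rate k (1 / z)"
    using assms by (intro tendsto_intros cosunflower_rate_limit) auto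
  moreover have "\<forall>\<^sub>F n in sequentially.
      z * root n (cosunflower_weight k n (1 / z)) = root n (sunflower_weight k n z)"
    using eventually_gt_at_top[of 0]
    by eventually_elim (use assms in \<open>simp add: sunflower_weight_eq real_root_mult real_root_power_cancel\<close>)
  ultimately show "(\<lambda>n. root n (sunflower_weight k n z)) \<longlonglongrightarrow> z * cosunflower_rate k (1 / z)"
    using tendsto_cong by fast
qed

section \<open>Weighted families and sets of primes\<close>

text \<open>Each weight is rounded up to a multiple of \<open>d\<close> and split into points of
  weight \<open>d\<close>, whose rate is at most \<open>exp (g * d)\<close>. Rounding costs at most
  \<open>d\<close> per point, which vanishes as \<open>d\<close> tends to 0.\<close>

lemma uniform_weight_le_exp:
  assumes k: "k \<ge> 3" and g: "g \<ge> 0" "\<And>u. u > 0 \<Longrightarrow> ln (cosunflower_rate k u) / u \<le> g"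
    and X: "finite X" and F: "uniform_free k X F" and w: "\<And>x. x \<in> X \<Longrightarrow> w x \<ge> 0"
  shows "fam_weight w F \<le> exp (g * (\<Sum>x\<in>X. w x))"
proof -
  have FX: "F \<subseteq> Pow X" using F by (simp add: uniform_free_def)
  have bound: "fam_weight w F \<le> exp (g * ((\<Sum>x\<in>X. w x) + d * real (card X)))" if d: "d > 0" for d :: real
  proof -
    let ?m = "\<lambda>x. nat \<lceil>w x / d\<rceil>"
    have m: "w x \<le> real (?m x) * d" "real (?m x) * d \<le> w x + d" if "x \<in> X" for x
    proof -
      have eq: "real (?m x) = of_int \<lceil>w x / d\<rceil>" using w[OF that] d by (simp add: less_le_trans[of "-1" 0])
      show "w x \<le> real (?m x) * d"
        unfolding eq pos_divide_le_eq[OF d, symmetric] by (rule le_of_int_ceiling)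
      have "of_int \<lceil>w x / d\<rceil> * d \<le> (w x / d + 1) * d"
        using d of_int_ceiling_le_add_one[of "w x / d"] by (intro mult_right_mono) auto
      then show "real (?m x) * d \<le> w x + d" unfolding eq using d by (simp add: distrib_right)
    qed
    have c: "cosunflower_rate k d \<ge> 1" by (rule cosunflower_rate_ge_1[OF k d])
    have "ln (cosunflower_rate k d) \<le> g * d" using g(2)[OF d] d by (simp add: pos_divide_le_eq)
    then have cd: "cosunflower_rate k d \<le> exp (g * d)" using c by (metis exp_le_cancel_iff exp_ln less_le_trans zero_less_one)
    have "fam_weight w F \<le> fam_weight (\<lambda>x. real (?m x) * d) F"
      using w m by (intro fam_weight_mono[OF FX]) auto
    also have "\<dots> \<le> cosunflower_rate k d ^ (\<Sum>x\<in>X. ?m x)"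
      by (rule fam_weight_blowup_le[OF k d X F])
    also have "\<dots> \<le> exp (g * d) ^ (\<Sum>x\<in>X. ?m x)" using c cd by (intro power_mono) auto
    also have "\<dots> = exp (g * (\<Sum>x\<in>X. real (?m x) * d))"
      by (simp add: exp_of_nat_mult[symmetric] sum_distrib_left sum_distrib_right mult_ac)
    also have "\<dots> \<le> exp (g * (\<Sum>x\<in>X. w x + d))"
      unfolding exp_le_cancel_iff using m g(1) by (intro mult_left_mono sum_mono) auto
    finally show ?thesis by (simp add: sum.distrib mult.commute)
  qed
  have "((\<lambda>d::real. exp (g * ((\<Sum>x\<in>X. w x) + d * real (card X)))) \<longlongrightarrow> exp (g * ((\<Sum>x\<in>X. w x) + 0 * real (card X)))) (at_right 0)"
    by (intro tendsto_intros)
  then show ?thesis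
    using bound by (intro tendsto_lowerbound[where F = "at_right (0::real)"])
      (auto intro!: eventually_at_rightI[of 0 1])
qed

lemma prod_one_plus_le_exp:
  assumes "\<And>x. x \<in> X \<Longrightarrow> w x \<ge> (0::real)"
  shows "(\<Prod>x\<in>X. 1 + w x) \<le> exp (\<Sum>x\<in>X. w x)"
proof (cases "finite X")
  case True
  have "(\<Prod>x\<in>X. 1 + w x) \<le> (\<Prod>x\<in>X. exp (w x))"
    using assms by (intro prod_mono) (auto intro: add_nonneg_nonneg)
  then show ?thesis using True by (simp add: exp_sum)
qed simp

text \<open>Summing over all sizes up to \<open>card X\<close> would be too lossy. Members of size
  at most \<open>R\<close> are handled layer by layer, and the larger ones have total weight at most
  1 by exponential tilting.\<close>

lemma fam_weight_le_exp:
  assumes k: "k \<ge> 3" and g: "g \<ge> 0" "\<And>u. u > 0 \<Longrightarrow> ln (cosunflower_rate k u) / u \<le> g"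
    and X: "finite X" and F: "F \<subseteq> Pow X" "cosunflower_free k F"
    and w: "\<And>x. x \<in> X \<Longrightarrow> w x \<ge> 0" and s: "(\<Sum>x\<in>X. w x) \<le> s"
  shows "fam_weight w F \<le> (3 * s + 3) * exp (g * s)"
proof -
  have s0: "s \<ge> 0" using sum_nonneg[of X w] w s by force
  \<comment> \<open>Since \<open>R\<close> is at least \<open>exp 1 * s\<close>, the tilted tail is
    at most \<open>exp (exp 1 * s - R) \<le> 1\<close>; as \<open>exp 1 \<le> 3\<close>, the number
    \<open>R + 1\<close> of layers stays at most \<open>3 * s + 2\<close>.\<close>
  define R where "R = nat \<lceil>exp 1 * s\<rceil>"
  have R: "exp 1 * s \<le> real R" "real R \<le> 3 * s + 1"
  proof -
    have eq: "real R = of_int \<lceil>exp 1 * s\<rceil>"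
      unfolding R_def using s0 by (simp add: less_le_trans[of "-1" 0])
    then show "exp 1 * s \<le> real R" by (simp add: le_of_int_ceiling)
    have "exp 1 * s \<le> 3 * s" using s0 exp_le by (rule mult_right_mono[rotated])
    then show "real R \<le> 3 * s + 1"
      unfolding eq using of_int_ceiling_le_add_one[of "exp 1 * s"] by linarith
  qed
  let ?F1 = "{S\<in>F. card S \<le> R}" and ?F2 = "{S\<in>F. \<not> card S \<le> R}"
  have finF: "finite F" using F(1) X by (simp add: finite_subset)
  have wS: "(\<Prod>x\<in>S. w x) \<ge> 0" if "S \<subseteq> X" for S using that w by (intro prod_nonneg) auto
  have "fam_weight w F = fam_weight w ?F1 + fam_weight w ?F2"
    unfolding fam_weight_def using finF
    by (subst sum.union_disjoint[symmetric]) (auto intro!: sum.cong)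
  moreover have "fam_weight w ?F1 \<le> (real R + 1) * exp (g * s)"
  proof (rule fam_weight_le_layers[OF X _ cosunflower_free_subset[OF F(2)]])
    fix G assume "uniform_free k X G"
    from uniform_weight_le_exp[OF k g X this w]
    have "fam_weight w G \<le> exp (g * (\<Sum>x\<in>X. w x))" .
    also have "\<dots> \<le> exp (g * s)" using g(1) s by (simp add: mult_left_mono)
    finally show "fam_weight w G \<le> exp (g * s)" .
  qed (use F in auto)
  moreover have "fam_weight w ?F2 \<le> 1"
  proof -
    \<comment> \<open>Multiplying every weight by \<open>exp 1\<close> gains
      \<open>exp (card S)\<close>, which exceeds \<open>exp R\<close> on these members; the sum may
      then be extended to all subsets, where it is a product.\<close>
    have "fam_weight w ?F2 \<le> (\<Sum>S\<in>?F2. exp (- real R) * (\<Prod>x\<in>S. exp 1 * w x))"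
      unfolding fam_weight_def
    proof (rule sum_mono)
      fix S assume S: "S \<in> ?F2"
      have "exp (- real R) * (\<Prod>x\<in>S. exp 1 * w x) = exp (real (card S) - real R) * (\<Prod>x\<in>S. w x)"
        by (simp add: prod.distrib exp_of_nat_mult[symmetric] exp_diff exp_minus field_simps)
      moreover have "1 * (\<Prod>x\<in>S. w x) \<le> exp (real (card S) - real R) * (\<Prod>x\<in>S. w x)"
        using S F(1) by (intro mult_right_mono wS) auto
      ultimately show "(\<Prod>x\<in>S. w x) \<le> exp (- real R) * (\<Prod>x\<in>S. exp 1 * w x)" by simp
    qed
    also have "\<dots> \<le> (\<Sum>S\<in>Pow X. exp (- real R) * (\<Prod>x\<in>S. exp 1 * w x))"
      using F(1) X w by (intro sum_mono2 mult_nonneg_nonneg prod_nonneg) auto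
    also have "\<dots> = exp (- real R) * (\<Prod>x\<in>X. 1 + exp 1 * w x)"
      by (simp add: sum_distrib_left[symmetric] sum_Pow_prod[OF X])
    also have "\<dots> \<le> exp (- real R) * exp (\<Sum>x\<in>X. exp 1 * w x)"
      using w by (intro mult_left_mono prod_one_plus_le_exp) auto
    also have "\<dots> = exp (exp 1 * (\<Sum>x\<in>X. w x) - real R)"
      by (simp add: exp_diff exp_minus sum_distrib_left field_simps)
    also have "\<dots> \<le> 1"
    proof -
      have "exp 1 * (\<Sum>x\<in>X. w x) \<le> exp 1 * s" using s by (intro mult_left_mono) auto
      then have "exp 1 * (\<Sum>x\<in>X. w x) \<le> real R" using R(1) by (rule order_trans)
      then show ?thesis by simp
    qed
    finally show ?thesis .
  qed
  \<comment> \<open>The tail is absorbed into one further term \<open>exp (g * s)\<close>, which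
    turns \<open>3 * s + 2\<close> into \<open>3 * s + 3\<close>.\<close>
  moreover have one: "1 \<le> exp (g * s)" using g(1) s0 by simp
  moreover have "(real R + 1) * exp (g * s) \<le> (3 * s + 2) * exp (g * s)"
    using R(2) by (intro mult_right_mono) auto
  ultimately have "fam_weight w F \<le> (3 * s + 2) * exp (g * s) + exp (g * s)"
    using one by linarith
  then show ?thesis by (simp add: algebra_simps)
qed

section \<open>Squarefree integers as sets of primes\<close>

definition prime_set :: "nat set \<Rightarrow> bool" where
  "prime_set S \<longleftrightarrow> finite S \<and> (\<forall>p\<in>S. prime p)"

lemma prime_set_subset: "prime_set P \<Longrightarrow> S \<subseteq> P \<Longrightarrow> prime_set S"
  unfolding prime_set_def by (auto intro: finite_subset)

lemma prime_set_Un: "prime_set S \<Longrightarrow> prime_set T \<Longrightarrow> prime_set (S \<union> T)"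
  unfolding prime_set_def by auto

lemma prime_factorization_prod_prime_set:
  assumes "prime_set S" shows "prime_factorization (\<Prod>S) = mset_set S"
proof -
  have "prime_factorization (prod_mset (mset_set S)) = mset_set S"
    using assms by (intro prime_factorization_prod_mset_primes) (auto simp: prime_set_def)
  then show ?thesis by (simp add: prod_unfold_prod_mset)
qed

lemma prime_factors_prod_prime_set: "prime_set S \<Longrightarrow> prime_factors (\<Prod>S) = S"
  by (simp add: prime_factorization_prod_prime_set) (simp add: prime_set_def)

lemma prod_prime_set_pos: "prime_set S \<Longrightarrow> \<Prod>S > 0"
  unfolding prime_set_def by (auto intro!: prod_pos prime_gt_0_nat)

lemma prime_set_prime_factors: "prime_set (prime_factors n)"
  unfolding prime_set_def using in_prime_factors_imp_prime by blast

lemma prod_prime_factors_squarefree: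
  fixes m :: nat
  assumes "squarefree m"
  shows "\<Prod>(prime_factors m) = m"
proof -
  have m0: "m \<noteq> 0" using assms not_squarefree_0 by metis
  have "(\<Prod>p\<in>prime_factors m. p ^ multiplicity p m) = (\<Prod>p\<in>prime_factors m. p)"
  proof (rule prod.cong[OF refl])
    fix p assume "p \<in> prime_factors m"
    then have "prime p" "multiplicity p m > 0" by (auto simp: prime_factors_multiplicity)
    then have "multiplicity p m = 1"
      using assms m0 by (simp add: squarefree_factorial_semiring'' le_antisym Suc_le_eq)
    then show "p ^ multiplicity p m = p" by simp
  qed
  then show ?thesis using m0 by (simp add: prime_factorization_nat[symmetric])
qed

text \<open>All multiplicities are 0 or 1, and \<open>lcm\<close> takes maxima of multiplicities,
  which for indicator functions is the union.\<close>

lemma lcm_prod_prime_sets: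
  assumes "prime_set S" "prime_set T"
  shows "lcm (\<Prod>S) (\<Prod>T) = \<Prod>(S \<union> T)"
proof -
  have "prime_factorization (lcm (\<Prod>S) (\<Prod>T)) = mset_set S \<union># mset_set T"
    using assms prod_prime_set_pos[OF assms(1)] prod_prime_set_pos[OF assms(2)]
    by (subst prime_factorization_lcm) (simp_all add: prime_factorization_prod_prime_set)
  also have "\<dots> = mset_set (S \<union> T)"
    using assms by (intro multiset_eqI) (auto simp: prime_set_def count_mset_set')
  also have "\<dots> = prime_factorization (\<Prod>(S \<union> T))"
    using assms by (simp add: prime_factorization_prod_prime_set prime_set_Un)
  finally show ?thesis
    using prod_prime_set_pos[OF assms(1)] prod_prime_set_pos[OF assms(2)]
      prod_prime_set_pos[OF prime_set_Un[OF assms]]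
    by (metis (no_types, lifting) lcm_eq_0_iff less_not_refl normalize_nat_def prime_factorization_unique id_apply)
qed

text \<open>\<open>Prod\<close> and \<open>prime_factors\<close> are mutually inverse between these
  sets and their products, and \<open>lcm\<close> corresponds to union, so distinctness and equality
  of the pairwise values transfer both ways.\<close>

lemma lcm_k_free_iff_cosunflower_free:
  assumes "\<And>S. S \<in> F \<Longrightarrow> prime_set S"
  shows "lcm_k_free k (Prod ` F) \<longleftrightarrow> cosunflower_free k F"
proof
  assume free: "lcm_k_free k (Prod ` F)"
  show "cosunflower_free k F"
  proof (rule cosunflower_freeI)
    fix S K assume inj: "inj_on S {1..k}" and S: "\<And>i. i \<in> {1..k} \<Longrightarrow> S i \<in> F"
      and K: "\<And>i j. i \<in> {1..k} \<Longrightarrow> j \<in> {1..k} \<Longrightarrow> i \<noteq> j \<Longrightarrow> S i \<union> S j = K"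
    let ?a = "\<lambda>i. \<Prod>(S i)"
    have pf: "prime_factors (?a i) = S i" if "i \<in> {1..k}" for i
      by (rule prime_factors_prod_prime_set[OF assms[OF S[OF that]]])
    have "inj_on ?a {1..k}"
    proof (rule inj_onI)
      fix i j assume ij: "i \<in> {1..k}" "j \<in> {1..k}" "?a i = ?a j"
      then have "S i = S j" using pf[OF ij(1)] pf[OF ij(2)] ij(3) by metis
      then show "i = j" by (rule inj_onD[OF inj _ ij(1,2)])
    qed
    moreover have "?a ` {1..k} \<subseteq> Prod ` F" by (intro image_subsetI imageI S)
    moreover have "lcm (?a i) (?a j) = \<Prod>K" if "i \<in> {1..k}" "j \<in> {1..k}" "i < j" for i j
      using lcm_prod_prime_sets[OF assms[OF S[OF that(1)]] assms[OF S[OF that(2)]]] K[OF that(1,2)] that(3)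
      by simp
    ultimately show False using free unfolding lcm_k_free_def by metis
  qed
next
  assume free: "cosunflower_free k F"
  show "lcm_k_free k (Prod ` F)"
    unfolding lcm_k_free_def
  proof (rule notI, elim exE conjE)
    fix a L assume inj: "inj_on a {1..k}" and a: "a ` {1..k} \<subseteq> Prod ` F"
      and L: "\<forall>i\<in>{1..k}. \<forall>j\<in>{1..k}. i < j \<longrightarrow> lcm (a i) (a j) = L"
    let ?S = "\<lambda>i. prime_factors (a i)"
    have S: "?S i \<in> F" "\<Prod>(?S i) = a i" if "i \<in> {1..k}" for i
    proof -
      have "a i \<in> Prod ` F" using subsetD[OF a imageI[OF that]] .
      then obtain T where T: "T \<in> F" "a i = \<Prod>T" by (rule imageE)
      then have "?S i = T" using prime_factors_prod_prime_set[OF assms[OF T(1)]] by simp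
      with T show "?S i \<in> F" "\<Prod>(?S i) = a i" by simp_all
    qed
    have "inj_on ?S {1..k}"
    proof (rule inj_onI)
      fix i j assume ij: "i \<in> {1..k}" "j \<in> {1..k}" "?S i = ?S j"
      then have "a i = a j" using S(2)[OF ij(1)] S(2)[OF ij(2)] ij(3) by metis
      then show "i = j" by (rule inj_onD[OF inj _ ij(1,2)])
    qed
    moreover have "?S i \<union> ?S j = prime_factors L" if "i \<in> {1..k}" "j \<in> {1..k}" "i < j" for i j
    proof -
      have "L = lcm (a i) (a j)" using L that by simp
      also have "\<dots> = lcm (\<Prod>(?S i)) (\<Prod>(?S j))" by (simp only: S(2)[OF that(1)] S(2)[OF that(2)])
      also have "\<dots> = \<Prod>(?S i \<union> ?S j)" by (intro lcm_prod_prime_sets prime_set_prime_factors)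
      finally show ?thesis
        by (simp only: prime_factors_prod_prime_set prime_set_Un prime_set_prime_factors)
    qed
    ultimately show False using cosunflower_freeD[OF free, of ?S "prime_factors L"] S(1) by blast
  qed
qed

section \<open>Reduction to squarefree integers\<close>

lemma lcm_k_free_descale:
  assumes "lcm_k_free k A" "c > 0" "(\<lambda>m. c * m) ` M \<subseteq> A"
  shows "lcm_k_free k M"
  unfolding lcm_k_free_def
proof (rule notI, elim exE conjE)
  fix a L assume inj: "inj_on a {1..k}" and a: "a ` {1..k} \<subseteq> M"
    and L: "\<forall>i\<in>{1..k}. \<forall>j\<in>{1..k}. i < j \<longrightarrow> lcm (a i) (a j) = L"
  have "inj_on (\<lambda>i. c * a i) {1..k}"
  proof (rule inj_onI)
    fix i j assume ij: "i \<in> {1..k}" "j \<in> {1..k}" "c * a i = c * a j"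
    then have "a i = a j" using assms(2) by simp
    then show "i = j" by (rule inj_onD[OF inj _ ij(1,2)])
  qed
  moreover have "(\<lambda>i. c * a i) ` {1..k} \<subseteq> A" using a assms(3) by fast
  moreover have "\<forall>i\<in>{1..k}. \<forall>j\<in>{1..k}. i < j \<longrightarrow> lcm (c * a i) (c * a j) = c * L"
    using L by (simp add: lcm_mult_left)
  ultimately show False using assms(1) unfolding lcm_k_free_def by blast
qed

text \<open>Each new term is at most \<open>1 / n - 1 / (n + 1)\<close>; the subtracted
  \<open>1 / n\<close> in the bound makes the induction telescope.\<close>

lemma sum_inverse_squares_le: "n \<ge> 1 \<Longrightarrow> (\<Sum>r=1..n. 1 / real r ^ 2) \<le> 2 - 1 / real n"
proof (induction n rule: dec_induct)
  case (step n)
  have "1 / real (Suc n) ^ 2 \<le> 1 / (real n * real (Suc n))"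
    using step by (intro divide_left_mono) (auto simp: power2_eq_square)
  also have "\<dots> = 1 / real n - 1 / real (Suc n)" using step by (simp add: field_simps)
  finally show ?case using step by simp
qed simp

text \<open>Group \<open>A\<close> by the square part \<open>r\<close>. Within a group the
  squarefree part determines the element, so the group contributes at most \<open>B / r ^ 2\<close>,
  and the inverse squares sum to at most 2. The hypothesis on \<open>B\<close> records that
  \<open>r ^ 2\<close> times \<open>M\<close> lies in \<open>A\<close>, so that freeness of
  \<open>A\<close> can be passed to \<open>M\<close> by descaling.\<close>

lemma sum_reciprocals_le:
  assumes A: "A \<subseteq> {1..N}"
    and B: "\<And>M r. M \<subseteq> {1..N} \<Longrightarrow> (\<And>m. m \<in> M \<Longrightarrow> squarefree m) \<Longrightarrow> r > 0 \<Longrightarrow>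
      (\<lambda>m. r ^ 2 * m) ` M \<subseteq> A \<Longrightarrow> (\<Sum>m\<in>M. 1 / real m) \<le> B"
  shows "(\<Sum>a\<in>A. 1 / real a) \<le> 2 * B"
proof (cases "N = 0")
  case True
  then show ?thesis using A B[of "{}" 1] by simp
next
  case False
  have finA: "finite A" using A by (rule finite_subset) simp
  have pos: "a > 0" "a \<le> N" if "a \<in> A" for a using that A by auto
  have dec: "a = square_part a ^ 2 * squarefree_part a" for a :: nat
    using squarefree_decompose[of a] by (simp add: mult.commute)
  have sq: "square_part a \<in> {1..N}" "squarefree_part a \<in> {1..N}" if "a \<in> A" for a
  proof -
    have "square_part a dvd a"
      by (rule dvd_trans[OF _ square_part_square_dvd]) simp
    moreover have "squarefree_part a dvd a"
      using dvd_triv_right[of "squarefree_part a" "square_part a ^ 2"] by (simp only: dec[symmetric])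
    ultimately have "square_part a \<le> a" "squarefree_part a \<le> a"
      using pos(1)[OF that] by (auto intro!: dvd_imp_le)
    moreover have "square_part a > 0" "squarefree_part a > 0"
      using pos(1)[OF that] by (auto intro!: gr0I)
    ultimately show "square_part a \<in> {1..N}" "squarefree_part a \<in> {1..N}"
      using pos(2)[OF that] by auto
  qed
  have B0: "B \<ge> 0" using B[of "{}" 1] by simp
  have "(\<Sum>a\<in>A. 1 / real a) = (\<Sum>r=1..N. \<Sum>a | a \<in> A \<and> square_part a = r. 1 / real a)"
    using finA sq by (intro sum.group[symmetric]) auto
  also have "\<dots> \<le> (\<Sum>r=1..N. 1 / real r ^ 2 * B)"
  proof (rule sum_mono)
    fix r assume r: "r \<in> {1..N}"
    let ?A = "{a. a \<in> A \<and> square_part a = r}"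
    let ?M = "squarefree_part ` ?A"
    have inj: "inj_on squarefree_part ?A"
    proof (rule inj_onI)
      fix a b assume ab: "a \<in> ?A" "b \<in> ?A" "squarefree_part a = squarefree_part b"
      have "a = square_part a ^ 2 * squarefree_part a" by (rule dec)
      also have "\<dots> = square_part b ^ 2 * squarefree_part b" using ab by simp
      also have "\<dots> = b" by (rule dec[symmetric])
      finally show "a = b" .
    qed
    have dec_r: "r ^ 2 * squarefree_part a = a" if "a \<in> ?A" for a
    proof -
      have "square_part a = r" using that by simp
      from dec[of a, unfolded this] show ?thesis by (rule sym)
    qed
    have "(\<Sum>a\<in>?A. 1 / real a) = (\<Sum>a\<in>?A. 1 / real r ^ 2 * (1 / real (squarefree_part a)))"
    proof (rule sum.cong[OF refl])
      fix a assume "a \<in> ?A"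
      then have "real a = real r ^ 2 * real (squarefree_part a)" by (metis dec_r of_nat_mult of_nat_power)
      then show "1 / real a = 1 / real r ^ 2 * (1 / real (squarefree_part a))" by simp
    qed
    also have "\<dots> = 1 / real r ^ 2 * (\<Sum>m\<in>?M. 1 / real m)"
      by (simp only: sum_distrib_left[symmetric] sum.reindex[OF inj] o_def)
    also have "\<dots> \<le> 1 / real r ^ 2 * B"
    proof (intro mult_left_mono B)
      show "?M \<subseteq> {1..N}" by (rule image_subsetI) (simp only: mem_Collect_eq sq(2))
      show "(\<lambda>m. r ^ 2 * m) ` ?M \<subseteq> A"
      proof (rule image_subsetI)
        fix m assume "m \<in> ?M"
        then obtain a where a: "m = squarefree_part a" "a \<in> ?A" by (rule imageE)
        then show "r ^ 2 * m \<in> A" using dec_r[OF a(2)] by simp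
      qed
    qed (use r in auto)
    finally show "(\<Sum>a\<in>?A. 1 / real a) \<le> 1 / real r ^ 2 * B" .
  qed
  also have "\<dots> = (\<Sum>r=1..N. 1 / real r ^ 2) * B" by (simp add: sum_distrib_right)
  also have "\<dots> \<le> 2 * B"
    using False sum_inverse_squares_le[of N] B0 by (intro mult_right_mono) (auto intro: order_trans)
  finally show ?thesis .
qed

section \<open>Sums over primes\<close>

lemma sum_squarefree_eq:
  fixes M :: "nat set"
  assumes "\<And>m. m \<in> M \<Longrightarrow> squarefree m"
  shows "(\<Sum>m\<in>M. h m) = (\<Sum>S\<in>prime_factors ` M. h (\<Prod>S))"
proof (rule sum.reindex_bij_witness[where i = Prod and j = prime_factors])
  fix m assume "m \<in> M"
  then show "\<Prod>(prime_factors m) = m" "h (\<Prod>(prime_factors m)) = h m"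
    using prod_prime_factors_squarefree[OF assms] by simp_all
next
  fix S assume "S \<in> prime_factors ` M"
  then obtain m where m: "S = prime_factors m" "m \<in> M" by (rule imageE)
  then show "prime_factors (\<Prod>S) = S" "\<Prod>S \<in> M"
    using prod_prime_factors_squarefree[OF assms] by simp_all
qed simp

text \<open>A discrete form of the integral comparison: the term at \<open>n + 1\<close> is at most
  \<open>(n powr - d - (n + 1) powr - d) / d\<close>, and these bounds telescope.\<close>

lemma sum_powr_le:
  assumes d: "d > 0" and "M \<ge> 1"
  shows "(\<Sum>n=1..M. real n powr - (1 + d)) \<le> 1 + 1 / d - real M powr - d / d"
  using assms(2)
proof (induction M rule: dec_induct)
  case (step n)
  let ?x = "real (Suc n)"
  have n: "real n > 0" using step by simp
  \<comment> \<open>The inequalities \<open>ln y \<le> y - 1\<close> and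
    \<open>1 + x \<le> exp x\<close> combine to
    \<open>1 + d / (n + 1) \<le> (n / (n + 1)) powr - d\<close>.\<close>
  have "ln (real n / ?x) \<le> real n / ?x - 1" using n by (intro ln_le_minus_one) auto
  also have "\<dots> = - 1 / ?x" by (simp add: field_simps)
  finally have "1 + d / ?x \<le> 1 + (- d) * ln (real n / ?x)"
    using mult_left_mono[of "ln (real n / ?x)" "- 1 / ?x" d] d by simp
  also have "\<dots> \<le> exp ((- d) * ln (real n / ?x))" by (rule exp_ge_add_one_self)
  also have "\<dots> = (real n / ?x) powr - d" using n by (simp add: powr_def)
  also have "\<dots> = real n powr - d / ?x powr - d" using n by (simp add: powr_divide)
  finally have "(1 + d / ?x) * ?x powr - d \<le> real n powr - d"
    by (simp add: pos_le_divide_eq)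
  moreover have "?x powr - (1 + d) = ?x powr - d / ?x"
    by (simp add: powr_diff powr_minus powr_add field_simps)
  ultimately have "d * (?x powr - (1 + d)) \<le> real n powr - d - ?x powr - d"
    by (simp add: algebra_simps)
  then have "?x powr - (1 + d) \<le> (real n powr - d - ?x powr - d) / d"
    using d by (simp add: pos_le_divide_eq mult.commute)
  then show ?case using step by (simp add: diff_divide_distrib)
qed (use d in simp)

text \<open>The finite Euler product of \<open>1 + p powr - (1 + d)\<close> expands into distinct
  squarefree integers, hence is at most the bound \<open>1 + 1 / d\<close> for the zeta sum.
  Logarithms with \<open>x - x\<^sup>2 \<le> ln (1 + x)\<close> leave the sum of the squares as an
  error of at most 1.\<close>

lemma sum_prime_powr_le:
  assumes P: "prime_set P" and d: "d > 0"
  shows "(\<Sum>p\<in>P. real p powr - (1 + d)) \<le> ln (1 + 1 / d) + 1"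
proof -
  let ?x = "\<lambda>p. real p powr - (1 + d)"
  have fin: "finite P" and pr: "\<And>p. p \<in> P \<Longrightarrow> prime p" using P by (auto simp: prime_set_def)
  have p2: "real p \<ge> 2" if "p \<in> P" for p using prime_ge_2_nat[OF pr[OF that]] by simp
  have x_le: "?x p \<le> 1 / real p" if "p \<in> P" for p
  proof -
    have "?x p \<le> real p powr - 1" using p2[OF that] d by (intro powr_mono) auto
    then show ?thesis using p2[OF that] by (simp add: powr_minus_divide)
  qed
  have x1: "?x p \<le> 1" if "p \<in> P" for p
    by (rule order_trans[OF x_le[OF that]]) (use p2[OF that] in simp)
  have "(\<Prod>p\<in>P. 1 + ?x p) = (\<Sum>S\<in>Pow P. \<Prod>p\<in>S. ?x p)" by (rule sum_Pow_prod[OF fin, symmetric])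
  also have "\<dots> = (\<Sum>S\<in>Pow P. real (\<Prod>S) powr - (1 + d))"
    by (intro sum.cong refl) (simp add: prod_powr_distrib)
  also have "\<dots> = (\<Sum>m\<in>Prod ` Pow P. real m powr - (1 + d))"
  proof (rule sum.reindex_cong[symmetric, where l = Prod])
    show "inj_on Prod (Pow P)"
      by (rule inj_on_inverseI[of _ prime_factors])
        (use prime_factors_prod_prime_set prime_set_subset[OF P] in blast)
  qed simp_all
  also have "\<dots> \<le> (\<Sum>m=1..\<Prod>P. real m powr - (1 + d))"
  proof (rule sum_mono2)
    show "Prod ` Pow P \<subseteq> {1..\<Prod>P}"
    proof (rule image_subsetI)
      fix S assume "S \<in> Pow P"
      then have S: "S \<subseteq> P" by simp
      have "\<Prod>S > 0" by (rule prod_prime_set_pos[OF prime_set_subset[OF P S]])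
      moreover have "\<Prod>S \<le> \<Prod>P"
        by (rule dvd_imp_le[OF prod_dvd_prod_subset[OF fin S] prod_prime_set_pos[OF P]])
      ultimately show "\<Prod>S \<in> {1..\<Prod>P}" by simp
    qed
  qed auto
  also have "\<dots> \<le> 1 + 1 / d - real (\<Prod>P) powr - d / d"
    using prod_prime_set_pos[OF P] by (intro sum_powr_le d) simp
  also have "\<dots> \<le> 1 + 1 / d" using d by simp
  finally have prod_le: "(\<Prod>p\<in>P. 1 + ?x p) \<le> 1 + 1 / d" .
  have pos: "0 < 1 + ?x p" for p by (rule add_pos_nonneg) simp_all
  have "(\<Sum>p\<in>P. ?x p - (?x p)\<^sup>2) \<le> (\<Sum>p\<in>P. ln (1 + ?x p))"
    using x1 by (intro sum_mono ln_one_plus_pos_lower_bound) auto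
  also have "\<dots> = ln (\<Prod>p\<in>P. 1 + ?x p)"
    using fin less_imp_neq[OF pos, symmetric] by (intro ln_prod[symmetric]) simp_all
  also have "\<dots> \<le> ln (1 + 1 / d)"
  proof (rule ln_mono)
    show "(\<Prod>p\<in>P. 1 + ?x p) > 0" by (intro prod_pos pos)
  qed (rule prod_le)
  finally have main: "(\<Sum>p\<in>P. ?x p) \<le> ln (1 + 1 / d) + (\<Sum>p\<in>P. (?x p)\<^sup>2)"
    by (simp add: sum_subtractf)
  have "(\<Sum>p\<in>P. (?x p)\<^sup>2) \<le> (\<Sum>p\<in>P. 1 / real p ^ 2)"
  proof (rule sum_mono)
    fix p assume "p \<in> P"
    then have "(?x p)\<^sup>2 \<le> (1 / real p)\<^sup>2" using x_le by (intro power_mono) auto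
    then show "(?x p)\<^sup>2 \<le> 1 / real p ^ 2" by (simp add: power_divide)
  qed
  also have "\<dots> \<le> 1"
  proof (cases "P = {}")
    case False
    let ?n = "Max P"
    have n: "p \<le> ?n" if "p \<in> P" for p using fin that by simp
    have n2: "?n \<ge> 2" using Max_in[OF fin False] pr prime_ge_2_nat by blast
    \<comment> \<open>Omitting the term at 1, which is no prime, lowers the bound on the sum of
      inverse squares from 2 to 1.\<close>
    have "P \<subseteq> {1..?n} - {1}"
    proof
      fix p assume "p \<in> P"
      then show "p \<in> {1..?n} - {1}" using prime_ge_2_nat[OF pr] n by force
    qed
    then have "(\<Sum>p\<in>P. 1 / real p ^ 2) \<le> (\<Sum>r\<in>{1..?n} - {1}. 1 / real r ^ 2)"
      by (intro sum_mono2) auto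
    also have "\<dots> = (\<Sum>r=1..?n. 1 / real r ^ 2) - 1"
      using n2 by (subst sum_diff1) auto
    also have "\<dots> \<le> 2 - 1 / real ?n - 1"
      using n2 by (intro diff_right_mono sum_inverse_squares_le) simp
    also have "\<dots> \<le> 1" by simp
    finally show ?thesis .
  qed simp
  finally show ?thesis using main by linarith
qed

section \<open>Upper bound for LCM-free sets\<close>

lemma finite_lcm_free_sums: "finite {\<Sum>a\<in>A. 1 / real a | A. A \<subseteq> {1..N} \<and> lcm_k_free k A}"
proof -
  have "{\<Sum>a\<in>A. 1 / real a | A. A \<subseteq> {1..N} \<and> lcm_k_free k A} \<subseteq> (\<lambda>A. \<Sum>a\<in>A. 1 / real a) ` Pow {1..N}"
    by blast
  then show ?thesis by (rule finite_subset) simp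
qed

lemma lcm_free_max_ge: "A \<subseteq> {1..N} \<Longrightarrow> lcm_k_free k A \<Longrightarrow> (\<Sum>a\<in>A. 1 / real a) \<le> lcm_free_max k N"
  unfolding lcm_free_max_def by (intro Max_ge finite_lcm_free_sums CollectI exI[of _ A]) simp

text \<open>Rankin's trick: for \<open>m \<le> N\<close> the weight \<open>1 / m\<close> is at most \<open>e m powr - (1 + 1 / ln N)\<close>, and the
  primes have total weight \<open>ln (ln N) + O(1)\<close> with respect to the new weights, so Mertens' theorem
  is not needed.\<close>

lemma lcm_free_max_le:
  assumes k: "k \<ge> 3" and g: "g \<ge> 0" "\<And>u. u > 0 \<Longrightarrow> ln (cosunflower_rate k u) / u \<le> g"
    and N: "N \<ge> 2"
  defines "s \<equiv> ln (1 + ln (real N)) + 1"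
  shows "lcm_free_max k N \<le> 2 * (exp 1 * ((3 * s + 3) * exp (g * s)))"
proof -
  define d where "d = 1 / ln (real N)"
  have d: "d > 0" using N by (simp add: d_def)
  let ?P = "{p. prime p \<and> p \<le> N}"
  let ?w = "\<lambda>p::nat. real p powr - (1 + d)"
  have P: "prime_set ?P" by (simp add: prime_set_def)
  have finP: "finite ?P" by simp
  have s: "(\<Sum>p\<in>?P. ?w p) \<le> s"
    using sum_prime_powr_le[OF P d] by (simp add: s_def d_def)
  have "{\<Sum>a\<in>A. 1 / real a | A. A \<subseteq> {1..N} \<and> lcm_k_free k A} \<noteq> {}"
  proof -
    have "lcm_k_free k {}" using k by (auto simp: lcm_k_free_def)
    then show ?thesis by blast
  qed
  from Max_in[OF finite_lcm_free_sums this] obtain A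
    where A: "A \<subseteq> {1..N}" "lcm_k_free k A" and max: "lcm_free_max k N = (\<Sum>a\<in>A. 1 / real a)"
    unfolding lcm_free_max_def by auto
  show ?thesis
    unfolding max
  \<comment> \<open>Removing square parts costs the factor 2. What remains are squarefree integers,
    whose sets of prime factors form a cosunflower-free family by descaling.\<close>
  proof (rule sum_reciprocals_le[OF A(1)])
    fix M and r :: nat
    assume M: "M \<subseteq> {1..N}" and sqf: "\<And>m. m \<in> M \<Longrightarrow> squarefree m"
      and r: "r > 0" and rM: "(\<lambda>m. r ^ 2 * m) ` M \<subseteq> A"
    let ?F = "prime_factors ` M"
    have PF: "Prod ` ?F = M"
      unfolding image_image using prod_prime_factors_squarefree[OF sqf] by simp
    have FP: "?F \<subseteq> Pow ?P"
    proof (rule image_subsetI, rule PowI, rule subsetI)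
      fix m p assume m: "m \<in> M" and p: "p \<in> prime_factors m"
      have "0 < m" "m \<le> N" using subsetD[OF M m] by simp_all
      moreover have "p dvd m" "prime p" using p by auto
      ultimately show "p \<in> ?P" using dvd_imp_le[of p m] by simp
    qed
    have ps: "prime_set S" if "S \<in> ?F" for S
      using that prime_set_prime_factors by blast
    have "lcm_k_free k M" by (rule lcm_k_free_descale[OF A(2) _ rM]) (use r in simp)
    then have free: "cosunflower_free k ?F"
      using lcm_k_free_iff_cosunflower_free[OF ps, of ?F k] PF by simp
    have "(\<Sum>m\<in>M. 1 / real m) \<le> (\<Sum>m\<in>M. exp 1 * real m powr - (1 + d))"
    proof (rule sum_mono)
      fix m assume "m \<in> M"
      then have m: "real m \<ge> 1" "real m \<le> real N" using M by auto
      have "real m powr d \<le> real N powr d" using m d by (intro powr_mono2) auto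
      also have "\<dots> = exp 1" using N by (simp add: powr_def d_def)
      finally have "1 \<le> exp 1 * real m powr - d" using m by (simp add: powr_minus field_simps)
      then have "1 / real m \<le> exp 1 * real m powr - d / real m"
        using m by (intro divide_right_mono) auto
      also have "\<dots> = exp 1 * real m powr - (1 + d)"
        using m by (simp add: powr_diff powr_minus powr_add field_simps)
      finally show "1 / real m \<le> exp 1 * real m powr - (1 + d)" .
    qed
    also have "\<dots> = exp 1 * (\<Sum>S\<in>?F. real (\<Prod>S) powr - (1 + d))"
      unfolding sum_distrib_left[symmetric] by (subst sum_squarefree_eq[OF sqf]) simp_all
    also have "\<dots> = exp 1 * fam_weight ?w ?F"
      unfolding fam_weight_def by (simp add: prod_powr_distrib)
    also have "\<dots> \<le> exp 1 * ((3 * s + 3) * exp (g * s))"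
      using fam_weight_le_exp[OF k g finP FP free _ s] by (intro mult_left_mono) auto
    finally show "(\<Sum>m\<in>M. 1 / real m) \<le> exp 1 * ((3 * s + 3) * exp (g * s))" .
  qed
qed

section \<open>Prime reciprocals and blocks of primes\<close>

text \<open>Euler's argument: \<open>ln Y\<close> is at most a harmonic sum, which after removal of
  square parts is at most twice the product of \<open>1 + 1 / p\<close>, and this product is at most
  \<open>exp\<close> of the sum of \<open>1 / p\<close>. The factor 2 becomes
  \<open>ln 2\<close>.\<close>

lemma sum_prime_reciprocals_ge:
  assumes Y: "Y > 1"
  shows "ln (ln Y) - ln 2 \<le> (\<Sum>p | prime p \<and> real p \<le> Y. 1 / real p)"
proof -
  define n where "n = nat \<lfloor>Y\<rfloor>"
  let ?P = "{p. prime p \<and> real p \<le> Y}"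
  have le_n: "p \<le> n \<longleftrightarrow> real p \<le> Y" for p using Y by (simp add: n_def le_nat_floor le_nat_iff le_floor_iff)
  have fin: "finite ?P" by (rule finite_subset[of _ "{..n}"]) (auto simp: le_n)
  have ln_le_harmonic: "ln (real m + 1) \<le> (\<Sum>a\<in>{1..m}. 1 / real a)" for m :: nat
  proof (induction m)
    case (Suc m)
    have "real (Suc m) + 1 = (real m + 1) * (1 + 1 / real (Suc m))" by (simp add: field_simps)
    then have "ln (real (Suc m) + 1) = ln ((real m + 1) * (1 + 1 / real (Suc m)))"
      by (rule arg_cong)
    also have "\<dots> = ln (real m + 1) + ln (1 + 1 / real (Suc m))"
      by (intro ln_mult_pos) (auto intro: add_pos_nonneg)
    also have "\<dots> \<le> ln (real m + 1) + 1 / real (Suc m)"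
      by (intro add_left_mono ln_add_one_self_le_self) simp
    finally show ?case using Suc by simp
  qed simp
  have "ln Y \<le> ln (real n + 1)"
  proof (rule ln_mono)
    show "Y \<le> real n + 1" using Y real_of_int_floor_add_one_ge[of Y] by (simp add: n_def)
  qed (use Y in auto)
  also have "\<dots> \<le> (\<Sum>a\<in>{1..n}. 1 / real a)" by (rule ln_le_harmonic)
  also have "\<dots> \<le> 2 * (\<Prod>p\<in>?P. 1 + 1 / real p)"
  proof (rule sum_reciprocals_le[OF order_refl])
    fix M assume M: "M \<subseteq> {1..n}" and sqf: "\<And>m. m \<in> M \<Longrightarrow> squarefree m"
    have "(\<Sum>m\<in>M. 1 / real m) = fam_weight (\<lambda>p. 1 / real p) (prime_factors ` M)"
      unfolding fam_weight_def by (subst sum_squarefree_eq[OF sqf]) (simp_all add: prod_dividef)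
    also have "\<dots> \<le> (\<Prod>p\<in>?P. 1 + 1 / real p)"
    proof (rule fam_weight_le_prod[OF fin])
      show "prime_factors ` M \<subseteq> Pow ?P"
      proof (rule image_subsetI, rule PowI, rule subsetI)
        fix m p assume m: "m \<in> M" and p: "p \<in> prime_factors m"
        have "0 < m" "m \<le> n" using subsetD[OF M m] by simp_all
        moreover have "p dvd m" "prime p" using p by auto
        ultimately show "p \<in> ?P" using dvd_imp_le[of p m] le_n[of p] by simp
      qed
    qed simp
    finally show "(\<Sum>m\<in>M. 1 / real m) \<le> (\<Prod>p\<in>?P. 1 + 1 / real p)" .
  qed
  also have "\<dots> \<le> 2 * exp (\<Sum>p\<in>?P. 1 / real p)"
    by (intro mult_left_mono prod_one_plus_le_exp) auto
  finally have "ln (ln Y) \<le> ln (2 * exp (\<Sum>p\<in>?P. 1 / real p))"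
    using Y by (intro ln_mono) auto
  then show ?thesis by (simp add: ln_mult)
qed

text \<open>Points are added one at a time; the first partial sum to reach \<open>u\<close>
  overshoots by at most one weight, hence by at most \<open>e\<close>.\<close>

lemma subset_sum_between:
  fixes w :: "'a \<Rightarrow> real"
  assumes "finite P" "e \<ge> 0" "u \<ge> 0" "\<And>x. x \<in> P \<Longrightarrow> w x \<le> e" "u \<le> sum w P"
  shows "\<exists>Q\<subseteq>P. u \<le> sum w Q \<and> sum w Q \<le> u + e"
  using assms(1,4,5)
proof (induction P rule: finite_induct)
  case empty
  then show ?case using assms by auto
next
  case (insert x P)
  show ?case
  proof (cases "u \<le> sum w P")
    case True
    then obtain Q where "Q \<subseteq> P" "u \<le> sum w Q" "sum w Q \<le> u + e"
      using insert.IH insert.prems by auto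
    then show ?thesis by blast
  next
    case False
    then have "sum w (insert x P) \<le> u + e" using insert.hyps insert.prems(1)[of x] by simp
    then show ?thesis using insert.prems(2) by blast
  qed
qed

text \<open>A block of weight between \<open>u\<close> and \<open>u + e\<close> is split off, and
  what is left still suffices for the other \<open>t\<close> blocks.\<close>

lemma blocks_exist:
  fixes w :: "'a \<Rightarrow> real"
  assumes "finite P" "e \<ge> 0" "u \<ge> 0" "\<And>x. x \<in> P \<Longrightarrow> 0 \<le> w x \<and> w x \<le> e"
    "real t * (u + e) \<le> sum w P"
  shows "\<exists>b. \<forall>j\<in>{1..t}. u \<le> (\<Sum>x | x \<in> P \<and> b x = j. w x)"
  using assms(1,4,5)
proof (induction t arbitrary: P)
  case (Suc t)
  have "0 \<le> real t * (u + e)" using assms by simp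
  then have "u \<le> sum w P" using Suc.prems(3) assms(2) by (simp add: algebra_simps)
  then obtain Q where Q: "Q \<subseteq> P" "u \<le> sum w Q" "sum w Q \<le> u + e"
    using subset_sum_between[OF Suc.prems(1) assms(2,3), of w] Suc.prems(2) by blast
  have "sum w (P - Q) = sum w P - sum w Q" using Q Suc.prems(1) by (intro sum_diff) auto
  then have "real t * (u + e) \<le> sum w (P - Q)" using Suc.prems(3) Q(3) by (simp add: algebra_simps)
  then have "\<exists>b. \<forall>j\<in>{1..t}. u \<le> (\<Sum>x | x \<in> P - Q \<and> b x = j. w x)"
    using Suc.prems(1,2) by (intro Suc.IH) simp_all
  then obtain b where b: "\<forall>j\<in>{1..t}. u \<le> (\<Sum>x | x \<in> P - Q \<and> b x = j. w x)" ..
  let ?b = "\<lambda>x. if x \<in> Q then Suc t else b x"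
  have "u \<le> (\<Sum>x | x \<in> P \<and> ?b x = j. w x)" if j: "j \<in> {1..Suc t}" for j
  proof (cases "j = Suc t")
    case True
    \<comment> \<open>Outside \<open>Q\<close> the labelling \<open>b\<close> may already take the
      value \<open>Suc t\<close>, so the fibre can be larger than \<open>Q\<close>; nonnegative
      weights make this harmless.\<close>
    have "sum w Q \<le> (\<Sum>x | x \<in> P \<and> ?b x = j. w x)"
      using Q(1) True Suc.prems(1,2) by (intro sum_mono2) auto
    then show ?thesis using Q(2) by linarith
  next
    case False
    then have "{x. x \<in> P \<and> ?b x = j} = {x. x \<in> P - Q \<and> b x = j}" by auto
    then show ?thesis using bspec[OF b, of j] False j by simp
  qed
  then show ?case by (intro exI[of _ ?b] ballI)
qed simp

text \<open>The primes are divided into \<open>t\<close> blocks of reciprocal sum at least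
  \<open>u\<close>, and an optimal uniform family on the blocks is pulled back to sets of primes
  without loss of weight. A transversal has at most \<open>t\<close> primes, each at most
  \<open>Y\<close>, so its product does not exceed \<open>N\<close>.\<close>

lemma lcm_free_max_ge_uniform_max:
  assumes k: "k \<ge> 3" and u: "u > 0" and e: "e \<ge> 0" and P: "prime_set P"
    and small: "\<And>p. p \<in> P \<Longrightarrow> 1 / real p \<le> e" and Y: "\<And>p. p \<in> P \<Longrightarrow> real p \<le> Y" "Y \<ge> 1"
    and sum: "real t * (u + e) \<le> (\<Sum>p\<in>P. 1 / real p)" and N: "Y ^ t \<le> real N"
  shows "uniform_max k t u \<le> lcm_free_max k N"
proof -
  let ?w = "\<lambda>p::nat. 1 / real p"
  have finP: "finite P" using P by (simp add: prime_set_def)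
  have "\<exists>b. \<forall>j\<in>{1..t}. u \<le> (\<Sum>x | x \<in> P \<and> b x = j. ?w x)"
    using u small by (intro blocks_exist[OF finP e _ _ sum]) simp_all
  then obtain b where b: "\<forall>j\<in>{1..t}. u \<le> (\<Sum>x | x \<in> P \<and> b x = j. ?w x)" ..
  obtain F where F: "uniform_free k {1..t} F" and max: "fam_weight (\<lambda>_. u) F = uniform_max k t u"
    using uniform_max_attained[OF k, of "{1..t}" u] by auto
  have FX: "F \<subseteq> Pow {1..t}" using F by (simp add: uniform_free_def)
  let ?T = "transversals b P F"
  have T: "uniform_free k P ?T" using F by (intro uniform_free_transversals[OF k]) auto
  then have TP: "?T \<subseteq> Pow P" by (simp add: uniform_free_def)
  have ps: "prime_set S" if "S \<in> ?T" for S
    by (rule prime_set_subset[OF P]) (use TP that in blast)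
  have "uniform_max k t u \<le> fam_weight (\<lambda>j. \<Sum>x | x \<in> P \<and> b x = j. ?w x) F"
    unfolding max[symmetric] using b u by (intro fam_weight_mono[OF FX]) simp
  also have "\<dots> = fam_weight ?w ?T"
    by (rule fam_weight_transversals[OF finP _ FX, symmetric]) simp
  also have "\<dots> = (\<Sum>S\<in>?T. 1 / real (\<Prod>S))"
    unfolding fam_weight_def by (simp add: prod_dividef)
  also have "\<dots> = (\<Sum>a\<in>Prod ` ?T. 1 / real a)"
  proof (rule sum.reindex_cong[symmetric, where l = Prod])
    show "inj_on Prod ?T"
      by (rule inj_on_inverseI[of _ prime_factors]) (use prime_factors_prod_prime_set ps in blast)
  qed simp_all
  also have "\<dots> \<le> lcm_free_max k N"
  proof (rule lcm_free_max_ge)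
    show "lcm_k_free k (Prod ` ?T)"
      using T lcm_k_free_iff_cosunflower_free[OF ps] by (simp add: uniform_free_def)
    show "Prod ` ?T \<subseteq> {1..N}"
    proof (rule image_subsetI)
      fix S assume S: "S \<in> ?T"
      then have SP: "S \<subseteq> P" and inj: "inj_on b S" and im: "b ` S \<in> F" by (auto simp: transversals_def)
      have "b ` S \<subseteq> {1..t}" using im FX by blast
      then have "card (b ` S) \<le> card {1..t}" by (intro card_mono) auto
      then have card: "card S \<le> t" using card_image[OF inj] by simp
      have "real (\<Prod>S) = (\<Prod>p\<in>S. real p)" by simp
      also have "\<dots> \<le> (\<Prod>p\<in>S. Y)" using SP Y(1) by (intro prod_mono) auto
      also have "\<dots> = Y ^ card S" by simp
      also have "\<dots> \<le> Y ^ t" using card Y(2) by (intro power_increasing) auto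
      also have "\<dots> \<le> real N" by (rule N)
      finally have "\<Prod>S \<le> N" by (simp only: of_nat_le_iff)
      moreover have "\<Prod>S > 0" by (rule prod_prime_set_pos[OF ps[OF S]])
      ultimately show "\<Prod>S \<in> {1..N}" by simp
    qed
  qed
  finally show ?thesis .
qed

section \<open>The exponent of LCM-free sets\<close>

lemma lcm_free_max_ge_1:
  assumes "k \<ge> 3" "N \<ge> 1" shows "lcm_free_max k N \<ge> 1"
proof -
  have "lcm_k_free k {1}"
    unfolding lcm_k_free_def
  proof (rule notI, elim exE conjE)
    fix a :: "nat \<Rightarrow> nat" assume inj: "inj_on a {1..k}" and a: "a ` {1..k} \<subseteq> {1}"
    have "a 1 \<in> {1}" "a 2 \<in> {1}" using assms(1) by (intro subsetD[OF a] imageI; simp)+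
    then show False using not_inj_on_first_two[of k a] inj assms(1) by simp
  qed
  then show ?thesis using lcm_free_max_ge[of "{1}" N k] assms(2) by simp
qed

text \<open>In \<open>lcm_free_max_le\<close> the parameter \<open>s\<close> is asymptotic to
  \<open>ln (ln N)\<close>, and the logarithm of the bound is \<open>g * s\<close> up to an error of
  order \<open>ln s\<close>; after division by \<open>ln (ln N)\<close> it tends to
  \<open>g\<close>.\<close>

lemma eventually_lcm_log_ratio_less:
  assumes k: "k \<ge> 3" and g: "g \<ge> 0" "\<And>u. u > 0 \<Longrightarrow> ln (cosunflower_rate k u) / u \<le> g"
    and y: "g < y"
  shows "\<forall>\<^sub>F N in sequentially. lcm_log_ratio k N < y"
proof -
  define s where "s N = ln (1 + ln (real N)) + 1" for N :: nat
  define h where "h N = (ln 2 + 1 + ln (3 * s N + 3)) / ln (ln (real N)) + g * (s N / ln (ln (real N)))"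
    for N :: nat
  have "(\<lambda>N. s N / ln (ln (real N))) \<longlonglongrightarrow> 1" unfolding s_def by real_asymp
  moreover have "(\<lambda>N. (ln 2 + 1 + ln (3 * s N + 3)) / ln (ln (real N))) \<longlonglongrightarrow> 0"
    unfolding s_def by real_asymp
  ultimately have "h \<longlonglongrightarrow> 0 + g * 1" unfolding h_def by (intro tendsto_intros)
  then have "\<forall>\<^sub>F N in sequentially. h N < y" using y by (intro order_tendstoD(2)) simp_all
  moreover have "\<forall>\<^sub>F N in sequentially. ln (ln (real N)) > 0" by real_asymp
  ultimately show ?thesis using eventually_ge_at_top[of 2]
  proof eventually_elim
    case (elim N)
    have "ln (real N) \<ge> 0" using elim by simp
    then have s: "s N \<ge> 1" by (simp add: s_def)
    have f1: "lcm_free_max k N \<ge> 1" using lcm_free_max_ge_1[OF k] elim by simp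
    have "ln (lcm_free_max k N) \<le> ln (2 * (exp 1 * ((3 * s N + 3) * exp (g * s N))))"
      using lcm_free_max_le[OF k g elim(3)] f1 by (intro ln_mono) (auto simp: s_def)
    also have "\<dots> = ln 2 + 1 + ln (3 * s N + 3) + g * s N"
      using s by (simp add: ln_mult)
    finally have "lcm_log_ratio k N \<le> h N"
      unfolding lcm_log_ratio_def h_def add_divide_distrib[symmetric] times_divide_eq_right
      using elim by (intro divide_right_mono) simp_all
    then show ?case using elim by linarith
  qed
qed

text \<open>Take \<open>t\<close> about \<open>\<theta> * ln (ln N)\<close> and primes up to the
  t-th root of \<open>N\<close>. Their reciprocal sum is at least \<open>ln (ln N) - ln t\<close> up
  to a constant, enough for \<open>t\<close> blocks of weight \<open>u\<close> because
  \<open>\<theta> * u < 1\<close>; the logarithm of the optimal weight on \<open>t\<close> points is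
  about \<open>t * ln (cosunflower_rate k u)\<close>.\<close>

lemma eventually_lcm_log_ratio_greater:
  assumes k: "k \<ge> 3" and u: "u > 0" and th: "\<theta> > 0" "\<theta> * u < 1"
    and y: "y < \<theta> * ln (cosunflower_rate k u)"
  shows "\<forall>\<^sub>F N in sequentially. y < lcm_log_ratio k N"
proof -
  \<comment> \<open>Half the slack between \<open>u\<close> and \<open>1 / \<theta>\<close>, so that
    blocks of weight up to \<open>u + e\<close> still satisfy
    \<open>\<theta> * (u + e) < 1\<close>.\<close>
  define e where "e = (1 / \<theta> - u) / 2"
  have e: "e > 0" using th by (simp add: e_def field_simps)
  have "u + e < 1 / \<theta>" using th by (simp add: e_def field_simps)
  then have a1: "\<theta> * (u + e) < 1" using th by (simp add: field_simps)
  define a where "a = \<theta> * (u + e)"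
  have a: "a < 1" using a1 by (simp add: a_def)
  \<comment> \<open>Primes below \<open>1 / e\<close> have reciprocals above \<open>e\<close> and
    are discarded; their total \<open>K\<close> does not depend on \<open>N\<close>.\<close>
  define K where "K = (\<Sum>p | prime p \<and> real p < 1 / e. 1 / real p)"
  define t where "t N = nat \<lfloor>\<theta> * ln (ln (real N))\<rfloor>" for N :: nat
  let ?x = "\<lambda>N::nat. ln (ln (real N))"
  have t_top: "filterlim t at_top sequentially"
  proof -
    have "filterlim (\<lambda>N::nat. \<lfloor>\<theta> * ?x N\<rfloor>) at_top sequentially"
      by (rule filterlim_compose[OF filterlim_floor_sequentially]) (use th in real_asymp)
    then show ?thesis unfolding t_def by (rule filterlim_compose[OF filterlim_nat_sequentially])
  qed
  have t_x: "(\<lambda>N. real (t N) / ?x N) \<longlonglongrightarrow> \<theta>"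
  proof (rule tendsto_sandwich)
    have x_pos: "\<forall>\<^sub>F N in sequentially. ?x N > 0" by real_asymp
    then show "\<forall>\<^sub>F N in sequentially. (\<theta> * ?x N - 1) / ?x N \<le> real (t N) / ?x N"
    proof eventually_elim
      case (elim N)
      have "\<theta> * ?x N - 1 \<le> real (t N)" unfolding t_def by linarith
      then show ?case using elim by (intro divide_right_mono) auto
    qed
    from x_pos show "\<forall>\<^sub>F N in sequentially. real (t N) / ?x N \<le> \<theta>"
    proof eventually_elim
      case (elim N)
      have "0 \<le> \<theta> * ?x N" using th elim by simp
      then have "real (t N) \<le> \<theta> * ?x N" unfolding t_def by linarith
      then show ?case using elim by (simp add: pos_divide_le_eq)
    qed
    show "(\<lambda>N. (\<theta> * ?x N - 1) / ?x N) \<longlonglongrightarrow> \<theta>" by real_asymp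
  qed simp
  have "(\<lambda>N. ln (uniform_max k (t N) u) / real (t N)) \<longlonglongrightarrow> ln (cosunflower_rate k u)"
    by (rule filterlim_compose[OF ln_uniform_max_limit[OF k u] t_top])
  from tendsto_mult[OF t_x this]
  have "\<forall>\<^sub>F N in sequentially. y < real (t N) / ?x N * (ln (uniform_max k (t N) u) / real (t N))"
    using y by (intro order_tendstoD(1))
  \<comment> \<open>Since \<open>a < 1\<close>, the linear term eventually pays for
    \<open>ln t\<close>, for the \<open>ln 2\<close> lost in the prime sum and for the discarded
    primes.\<close>
  moreover have "\<forall>\<^sub>F N in sequentially. 0 \<le> (1 - a) * ?x N - ln (\<theta> * ?x N) - ln 2 - K"
    using a th by real_asymp
  moreover have "\<forall>\<^sub>F N in sequentially. t N \<ge> 1"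
    using t_top by (simp add: filterlim_at_top)
  moreover have "\<forall>\<^sub>F N in sequentially. ?x N > 0" by real_asymp
  ultimately show ?thesis using eventually_ge_at_top[of 3]
  proof eventually_elim
    case (elim N)
    let ?t = "real (t N)"
    \<comment> \<open>The t-th root of \<open>N\<close>, the largest \<open>Y\<close> with
      \<open>Y ^ t \<le> N\<close>; hence \<open>ln (ln Y) = ln (ln N) - ln t\<close>.\<close>
    define Y where "Y = exp (ln (real N) / ?t)"
    have t1: "?t \<ge> 1" using elim by simp
    have lnN: "ln (real N) > 0" using elim by simp
    have "0 \<le> \<theta> * ?x N" using th elim by simp
    then have t_le: "?t \<le> \<theta> * ?x N" unfolding t_def by linarith
    have Y1: "Y > 1" using lnN t1 by (simp add: Y_def)
    let ?Q = "{p. prime p \<and> real p \<le> Y}" and ?R = "{p. prime p \<and> real p < 1 / e}"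
    have finite_le: "finite {p::nat. real p \<le> B}" for B
      by (rule finite_subset[of _ "{..nat \<lfloor>B\<rfloor>}"]) (auto simp: le_nat_floor)
    have fin: "finite ?Q" by (rule finite_subset[OF _ finite_le[of Y]]) auto
    have finR: "finite ?R" by (rule finite_subset[OF _ finite_le[of "1 / e"]]) auto
    let ?P = "?Q - ?R"
    have P: "prime_set ?P" using fin by (simp add: prime_set_def)
    have "ln (ln Y) = ?x N - ln ?t"
      using lnN t1 by (simp add: Y_def ln_div)
    moreover have "ln ?t \<le> ln (\<theta> * ?x N)" using t1 t_le by (intro ln_mono) auto
    moreover have "ln (ln Y) - ln 2 \<le> (\<Sum>p\<in>?Q. 1 / real p)" by (rule sum_prime_reciprocals_ge[OF Y1])
    moreover have "(\<Sum>p\<in>?Q. 1 / real p) \<le> (\<Sum>p\<in>?P. 1 / real p) + K"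
    proof -
      have "(\<Sum>p\<in>?Q. 1 / real p) \<le> (\<Sum>p\<in>?P \<union> ?R. 1 / real p)"
        using fin finR by (intro sum_mono2) auto
      also have "\<dots> = (\<Sum>p\<in>?P. 1 / real p) + K"
        unfolding K_def using fin finR by (intro sum.union_disjoint) auto
      finally show ?thesis .
    qed
    moreover have "?t * (u + e) \<le> a * ?x N"
      using mult_right_mono[OF t_le, of "u + e"] u e by (simp add: a_def mult_ac)
    ultimately have sum: "?t * (u + e) \<le> (\<Sum>p\<in>?P. 1 / real p)"
      using elim(2) by (simp add: algebra_simps)
    have small: "1 / real p \<le> e" if "p \<in> ?P" for p
    proof -
      have "1 / e \<le> real p" "real p > 0" using that prime_gt_0_nat by auto
      then show ?thesis using e by (simp add: field_simps)
    qed
    have "Y ^ t N = exp (?t * (ln (real N) / ?t))" unfolding Y_def by (rule exp_of_nat_mult[symmetric])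
    also have "\<dots> = real N" using t1 elim by simp
    finally have YN: "Y ^ t N \<le> real N" by simp
    have "uniform_max k (t N) u \<le> lcm_free_max k N"
      using Y1 e by (intro lcm_free_max_ge_uniform_max[OF k u _ P small _ _ sum YN]) auto
    then have "ln (uniform_max k (t N) u) \<le> ln (lcm_free_max k N)"
      using uniform_max_ge_1[OF k, of "t N" u] by (intro ln_mono) auto
    then have "ln (uniform_max k (t N) u) / ?x N \<le> lcm_log_ratio k N"
      unfolding lcm_log_ratio_def using elim by (intro divide_right_mono) simp_all
    moreover have "?t / ?x N * (ln (uniform_max k (t N) u) / ?t) = ln (uniform_max k (t N) u) / ?x N"
      using t1 by simp
    ultimately show ?case using elim(1) by linarith
  qed
qed

section \<open>Extremal characterisations and conclusion\<close>

text \<open>An upper bound on the positive reals that is also approached along a filter concentrated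
  there is the supremum; the filter can be \<open>at_top\<close> or
  \<open>at_right 0\<close>.\<close>

lemma ereal_SUP_eq_limit:
  fixes f :: "real \<Rightarrow> real"
  assumes "\<And>x. x > 0 \<Longrightarrow> f x \<le> g" "(f \<longlongrightarrow> g) F" "\<forall>\<^sub>F x in F. x > 0" "F \<noteq> bot"
  shows "ereal g = (SUP x\<in>{0<..}. ereal (f x))"
proof (rule SUP_eqI[symmetric])
  fix y assume y: "\<And>x. x \<in> {0<..} \<Longrightarrow> ereal (f x) \<le> y"
  have "((\<lambda>x. ereal (f x)) \<longlongrightarrow> ereal g) F" using assms(2) by simp
  then show "ereal g \<le> y"
    by (rule tendsto_upperbound[OF _ _ assms(4)]) (use assms(3) y in \<open>auto elim: eventually_mono\<close>)
qed (use assms(1) in simp)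

lemma ereal_INF_eq_limit:
  fixes f :: "real \<Rightarrow> real"
  assumes "\<And>x. x > 0 \<Longrightarrow> g \<le> f x" "(f \<longlongrightarrow> g) F" "\<forall>\<^sub>F x in F. x > 0" "F \<noteq> bot"
  shows "ereal g = (INF x\<in>{0<..}. ereal (f x))"
proof (rule INF_eqI[symmetric])
  fix y assume y: "\<And>x. x \<in> {0<..} \<Longrightarrow> y \<le> ereal (f x)"
  have "((\<lambda>x. ereal (f x)) \<longlongrightarrow> ereal g) F" using assms(2) by simp
  then show "y \<le> ereal g"
    by (rule tendsto_lowerbound[OF _ _ assms(4)]) (use assms(3) y in \<open>auto elim: eventually_mono\<close>)
qed (use assms(1) in simp)

text \<open>For \<open>y < g\<close> first choose \<open>u\<close> with
  \<open>y < ln (c u) / u\<close>, where \<open>c\<close> is the cosunflower rate, and then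
  \<open>\<theta>\<close> just below \<open>1 / u\<close>, so that the lower bound
  \<open>\<theta> * ln (c u)\<close> still exceeds \<open>y\<close>.\<close>

lemma lcm_log_ratio_tendsto:
  assumes k: "k \<ge> 3" and g: "g \<ge> 0" "\<And>u. u > 0 \<Longrightarrow> ln (cosunflower_rate k u) / u \<le> g"
    and lim: "((\<lambda>u. ln (cosunflower_rate k u) / u) \<longlongrightarrow> g) (at_right 0)"
  shows "lcm_log_ratio k \<longlonglongrightarrow> g"
proof (rule order_tendstoI)
  fix y assume "y < g"
  then have "\<forall>\<^sub>F u in at_right 0. y < ln (cosunflower_rate k u) / u \<and> u > 0"
    by (intro eventually_conj order_tendstoD(1)[OF lim] eventually_at_right_less)
  then obtain u where u: "y < ln (cosunflower_rate k u) / u" "u > 0"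
    using eventually_happens[of _ "at_right (0::real)"] by auto
  have "((\<lambda>\<theta>. \<theta> * ln (cosunflower_rate k u)) \<longlongrightarrow> 1 / u * ln (cosunflower_rate k u)) (at_left (1 / u))"
    by (intro tendsto_intros)
  then have "\<forall>\<^sub>F \<theta> in at_left (1 / u). y < \<theta> * ln (cosunflower_rate k u)"
    using u by (intro order_tendstoD(1)) simp_all
  moreover have "\<forall>\<^sub>F \<theta> in at_left (1 / u). \<theta> \<in> {0<..<1 / u}"
    using u by (intro eventually_at_leftI) auto
  ultimately have "\<forall>\<^sub>F \<theta> in at_left (1 / u). y < \<theta> * ln (cosunflower_rate k u) \<and> \<theta> \<in> {0<..<1 / u}"
    by (rule eventually_conj)
  then obtain \<theta> where "y < \<theta> * ln (cosunflower_rate k u)" "\<theta> > 0" "\<theta> < 1 / u"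
    using eventually_happens[of _ "at_left (1 / u)"] by auto
  then show "\<forall>\<^sub>F N in sequentially. y < lcm_log_ratio k N"
    using u by (intro eventually_lcm_log_ratio_greater[OF k u(2)]) (auto simp: pos_less_divide_eq)
qed (rule eventually_lcm_log_ratio_less[OF k g])

theorem theorem4p1:
  fixes k :: nat
  assumes "k \<ge> 3"
  shows "lcm_lower_exponent k = lcm_upper_exponent k \<and>
    (\<exists>\<gamma> :: real.
       lcm_log_ratio k \<longlonglongrightarrow> \<gamma> \<and>
       ereal \<gamma> = lcm_lower_exponent k \<and>
       ereal \<gamma> = lcm_upper_exponent k \<and>
       ((\<lambda>z. sunflower_rate k z - z) \<longlongrightarrow> \<gamma>) at_top \<and>
       ereal \<gamma> = (INF z\<in>{0<..}. ereal (sunflower_rate k z - z)) \<and>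
       ereal \<gamma> = (SUP z\<in>{0<..}. ereal (z * ln (sunflower_rate k z / z))) \<and>
       ereal \<gamma> = (SUP u\<in>{0<..}. ereal (ln (cosunflower_rate k u) / u)) \<and>
       ((\<lambda>u. (cosunflower_rate k u - 1) / u) \<longlongrightarrow> \<gamma>) (at_right 0))"
proof -
  let ?c = "cosunflower_rate k"
  obtain g where g0: "g \<ge> 0" and g_le: "\<And>u. u > 0 \<Longrightarrow> g \<le> (?c u - 1) / u"
    and le_g: "\<And>u. u > 0 \<Longrightarrow> ln (?c u) / u \<le> g"
    and lim: "((\<lambda>u. (?c u - 1) / u) \<longlongrightarrow> g) (at_right 0)"
    and ln_lim: "((\<lambda>u. ln (?c u) / u) \<longlongrightarrow> g) (at_right 0)"
    using cosunflower_exponent_exists[OF assms] by blast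
  have ratio: "lcm_log_ratio k \<longlonglongrightarrow> g" by (rule lcm_log_ratio_tendsto[OF assms g0 le_g ln_lim])
  then have ratio': "(\<lambda>N. ereal (lcm_log_ratio k N)) \<longlonglongrightarrow> ereal g" by simp
  have lower: "ereal g = lcm_lower_exponent k" and upper: "ereal g = lcm_upper_exponent k"
    unfolding lcm_lower_exponent_def lcm_upper_exponent_def
    using lim_imp_Liminf[OF trivial_limit_sequentially ratio']
      lim_imp_Limsup[OF trivial_limit_sequentially ratio'] by simp_all
  \<comment> \<open>The substitution \<open>u = inverse z\<close> carries the statements on the
    cosunflower rate near 0 to the sunflower rate near infinity.\<close>
  have sub: "sunflower_rate k z - z = (?c (inverse z) - 1) / inverse z"
    and ln_sub: "z * ln (sunflower_rate k z / z) = ln (?c (inverse z)) / inverse z" if "z > 0" for z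
    using that by (simp_all add: sunflower_rate_eq[OF assms that] field_simps)
  have pos: "\<forall>\<^sub>F z::real in at_top. z > 0" by (rule eventually_gt_at_top)
  have sun_lim: "((\<lambda>z. sunflower_rate k z - z) \<longlongrightarrow> g) at_top"
    by (rule Lim_transform_eventually[OF filterlim_compose[OF lim filterlim_inverse_at_right_top]])
      (use pos in eventually_elim, simp only: sub)
  have sun_ln_lim: "((\<lambda>z. z * ln (sunflower_rate k z / z)) \<longlongrightarrow> g) at_top"
    by (rule Lim_transform_eventually[OF filterlim_compose[OF ln_lim filterlim_inverse_at_right_top]])
      (use pos in eventually_elim, simp only: ln_sub)
  have "ereal g = (INF z\<in>{0<..}. ereal (sunflower_rate k z - z))"
    by (rule ereal_INF_eq_limit[OF _ sun_lim pos]) (use sub g_le in auto)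
  moreover have "ereal g = (SUP z\<in>{0<..}. ereal (z * ln (sunflower_rate k z / z)))"
    by (rule ereal_SUP_eq_limit[OF _ sun_ln_lim pos]) (use ln_sub le_g in auto)
  moreover have "ereal g = (SUP u\<in>{0<..}. ereal (ln (?c u) / u))"
    by (rule ereal_SUP_eq_limit[OF le_g ln_lim eventually_at_right_less]) simp_all
  ultimately show ?thesis using ratio lower upper sun_lim lim by metis
qed

end
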